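(* There exist absolute constants $C,c>0$ such that the following holds. Let $A$ be a nonzero real $m\times n$ matrix with numerical rank $r=\|A\|_F^2/\|A\|_2^2$. Let $\varepsilon,\delta\in(0,1)$ and let $d\le m$ be an integer with $$d\ \ge\ C\,\frac{r}{\varepsilon^4\delta}\,\log\Bigl(\frac{r}{\varepsilon^4\delta}\Bigr).$$ Form a random $d\times n$ matrix $\tilde A$ as follows: independently for $s=1,\dots,d$, pick a row index $j_s\in\{1,\dots,m\}$ with $\mathbb P(j_s=j)=\|A_j\|_2^2/\|A\|_F^2$ (where $A_j$ is the $j$-th row of $A$), and let the $s$-th row of $\tilde A$ be $A_{j_s}/\|A_{j_s}\|_2$. Then with probability at least $1-2\exp(-c/\delta)$ the following holds simultaneously for every positive integer $k$: $$\|A-AP_k\|_2\ \le\ \sigma_{k+1}(A)+\varepsilon\|A\|_2,$$ where $P_k$ is the $n\times n$ orthogonal projection defined below.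
   Context: $\|\cdot\|_2$ denotes the spectral norm (operator norm $\ell_2\to\ell_2$) of a matrix and the Euclidean norm of a vector; $\|A\|_F$ is the Frobenius norm; $\sigma_1(A)\ge\sigma_2(A)\ge\dots\ge0$ are the singular values of $A$ (with $\sigma_j(A)=0$ for $j$ exceeding $\min(m,n)$). $P_k$ is the orthogonal projection in $\mathbb R^n$ onto the span of the singular vectors of $\tilde A$ lying in $\mathbb R^n$ (i.e. eigenvectors of $\tilde A^T\tilde A$) that correspond to the $k$ largest singular values of $\tilde A$, using only singular vectors with nonzero singular value (so if $k\ge \mathrm{rank}\,\tilde A$, $P_k$ is the projection onto the row space of $\tilde A$). Multiplying all rows of $\tilde A$ by a common positive scalar does not change $P_k$. *)

theory Defs
  imports "Jordan_Normal_Form.Char_Poly" "HOL-Computational_Algebra.Polynomial"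
begin

definition vnorm :: "real vec \<Rightarrow> real" where
  "vnorm v = sqrt (v \<bullet> v)"

definition fro_norm :: "real mat \<Rightarrow> real" where
  "fro_norm A = sqrt (\<Sum>i<dim_row A. \<Sum>j<dim_col A. (A $$ (i, j))\<^sup>2)"

definition spec_norm :: "real mat \<Rightarrow> real" where
  "spec_norm A = Sup {vnorm (A *\<^sub>v x) | x. x \<in> carrier_vec (dim_col A) \<and> vnorm x \<le> 1}"

text \<open>Singular values, 1-based: sing_val A j is the square root of the j-th largest
  eigenvalue (with multiplicity) of A^T A, for 1 <= j <= n; it is 0 for other j
  (for min(m,n) < j <= n the corresponding eigenvalues are 0 anyway).\<close>
definition sing_val :: "real mat \<Rightarrow> nat \<Rightarrow> real" where
  "sing_val A j = (if 1 \<le> j \<and> j \<le> dim_col A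
     then sqrt (rev (sorted_list_of_multiset (proots (char_poly (transpose_mat A * A)))) ! (j - 1))
     else 0)"

text \<open>P is a (choice of) P_k for the matrix At: the orthogonal projection onto the span of
  orthonormal eigenvectors of At^T At belonging to the min(k, rank At) largest singular values
  (only nonzero singular values are used).\<close>
definition is_top_proj :: "real mat \<Rightarrow> nat \<Rightarrow> real mat \<Rightarrow> bool" where
  "is_top_proj At k P \<longleftrightarrow>
    (let n = dim_col At; k' = card {i \<in> {1..k}. sing_val At i > 0} in
     \<exists>vs :: real vec list.
       length vs = k' \<and>
       (\<forall>i<k'. eigenvector (transpose_mat At * At) (vs ! i) ((sing_val At (i + 1))\<^sup>2)) \<and>
       (\<forall>i<k'. \<forall>j<k'. (vs ! i) \<bullet> (vs ! j) = (if i = j then 1 else 0)) \<and>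
       P = mat n n (\<lambda>(a, b). \<Sum>i<k'. (vs ! i) $ a * (vs ! i) $ b))"

definition sampled_mat :: "real mat \<Rightarrow> nat \<Rightarrow> (nat \<Rightarrow> nat) \<Rightarrow> real mat" where
  "sampled_mat A d J = mat d (dim_col A) (\<lambda>(s, l). A $$ (J s, l) / vnorm (row A (J s)))"

text \<open>Probability (under i.i.d. row sampling with P(j_s = j) = |A_j|^2 / |A|_F^2) that the
  event E holds for the index sequence J = (j_0, ..., j_(d-1)).\<close>
definition sample_prob :: "real mat \<Rightarrow> nat \<Rightarrow> ((nat \<Rightarrow> nat) \<Rightarrow> bool) \<Rightarrow> real" where
  "sample_prob A d E =
    (\<Sum>J \<in> PiE {0..<d} (\<lambda>_. {0..<dim_row A}).
       if E J then (\<Prod>s<d. (vnorm (row A (J s)))\<^sup>2 / (fro_norm A)\<^sup>2) else 0)"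

end

theory Submission
  imports Defs "Jordan_Normal_Form.Schur_Decomposition" "HOL-Combinatorics.List_Permutation"
begin

text \<open>Write \<open>y\<^sub>j\<close> for the normalised rows of \<open>A\<close>, \<open>\<Sigma> = A\<^sup>T A / \<parallel>A\<parallel>\<^sub>F\<^sup>2\<close> for the mean of the random projection
  \<open>y y\<^sup>T\<close>, and \<open>M\<close> for the sum of the \<open>d\<close> centred samples \<open>y y\<^sup>T - \<Sigma>\<close>. The probabilistic part bounds
  \<open>E tr M\<^sup>2\<^sup>p\<close> by exchangeable pairs: resampling one summand of \<open>M\<close> and the trace inequality
  \<open>tr (A - B) (A\<^sup>q - B\<^sup>q) \<le> q/2 tr (A - B)\<^sup>2 (A\<^sup>q\<^sup>-\<^sup>1 + B\<^sup>q\<^sup>-\<^sup>1)\<close> for odd \<open>q\<close> give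
  \<open>E tr M\<^sup>q\<^sup>+\<^sup>1 \<le> q E tr (M + 2 d \<Sigma>) M\<^sup>q\<^sup>-\<^sup>1 \<le> q E tr M\<^sup>q + 2 q (d/r) E tr M\<^sup>q\<^sup>-\<^sup>1\<close>, because \<open>y y\<^sup>T\<close> is its own
  square and \<open>\<Sigma> \<le> 1/r\<close>. Starting from \<open>E tr M\<^sup>2 \<le> 2 d\<close> this yields
  \<open>E tr M\<^sup>2\<^sup>p \<le> 2 d (10 p d / r)\<^sup>p\<^sup>-\<^sup>1\<close> with no dependence on the dimension, and Markov's inequality with
  \<open>p\<close> of order \<open>d \<epsilon>\<^sup>4 / r\<close> shows that \<open>A\<^sup>T A\<close> and the rescaled Gram matrix of the sample differ by at most
  \<open>\<epsilon>\<^sup>2 \<parallel>A\<parallel>\<^sup>2 / 2\<close> in norm outside the exceptional event. A max-min argument then gives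
  \<open>\<parallel>A - A P\<^sub>k\<parallel>\<^sup>2 \<le> \<sigma>\<^sub>k\<^sub>+\<^sub>1\<^sup>2 + \<epsilon>\<^sup>2 \<parallel>A\<parallel>\<^sup>2\<close>.\<close>

section \<open>The spectral theorem for real symmetric matrices\<close>

lemma scalar_prod_ge_0_real: "0 \<le> v \<bullet> (v :: real vec)"
  unfolding scalar_prod_def by (simp add: sum_nonneg)

lemma vnorm_nonneg [simp]: "0 \<le> vnorm v"
  unfolding vnorm_def by (simp add: scalar_prod_ge_0_real)

lemma vnorm_sq: "(vnorm v)\<^sup>2 = v \<bullet> v"
  unfolding vnorm_def by (simp add: scalar_prod_ge_0_real)

lemma scalar_prod_self_eq_0_iff:
  fixes v :: "real vec"
  assumes "v \<in> carrier_vec n"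
  shows "v \<bullet> v = 0 \<longleftrightarrow> v = 0\<^sub>v n"
  using conjugate_square_eq_0_vec[OF assms] conjugate_vec_def by (simp add: conjugate_real_def vec_eq_iff)

lemma symmetric_scalar_prod_mult:
  fixes A :: "'a :: comm_semiring_0 mat"
  assumes A: "A \<in> carrier_mat n n" "transpose_mat A = A" and x: "x \<in> carrier_vec n" and y: "y \<in> carrier_vec n"
  shows "(A *\<^sub>v x) \<bullet> y = x \<bullet> (A *\<^sub>v y)"
  using transpose_vec_mult_scalar[OF A(1) y x] A(2) by simp

text \<open>Over the complex numbers the characteristic polynomial splits, which yields an eigenpair
  \<open>v\<close>, \<open>z\<close>. Symmetry moves the matrix across the Hermitian product and
  gives \<open>z = cnj z\<close>.\<close>

lemma exists_real_eigenvector_symmetric: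
  fixes A :: "real mat"
  assumes A: "A \<in> carrier_mat n n" "transpose_mat A = A" and n: "n > 0"
  shows "\<exists>v e. eigenvector A v e"
proof -
  let ?A = "map_mat complex_of_real A"
  have cA: "?A \<in> carrier_mat n n" using A by simp
  from char_poly_factorized[OF cA] obtain as where
    as: "char_poly ?A = (\<Prod>a\<leftarrow>as. [:- a, 1:])" "length as = n" by auto
  from n as(2) obtain z zs where "as = z # zs" by (cases as) auto
  then have root: "poly (char_poly ?A) z = 0" using as by simp
  then have "eigenvalue ?A z" using eigenvalue_root_char_poly[OF cA] by simp
  then obtain v where v: "v \<in> carrier_vec n" "v \<noteq> 0\<^sub>v n" "?A *\<^sub>v v = z \<cdot>\<^sub>v v"
    unfolding eigenvalue_def eigenvector_def using cA by auto
  have "A $$ (j,i) = A $$ (i,j)" if "i < n" "j < n" for i j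
    using A that by (metis carrier_matD index_transpose_mat(1))
  then have tA: "transpose_mat ?A = ?A" using A(1) by (intro eq_matI) simp_all
  have cv: "conjugate v \<in> carrier_vec n" using v by simp
  have "?A *\<^sub>v conjugate v = conjugate (?A *\<^sub>v v)"
    using v(1) A(1) by (intro eq_vecI) (auto simp: scalar_prod_def)
  then have Acv: "?A *\<^sub>v conjugate v = conjugate z \<cdot>\<^sub>v conjugate v"
    using v(3) by (simp add: conjugate_smult_vec)
  have "z * (v \<bullet>c v) = (?A *\<^sub>v v) \<bullet>c v" using v cv by simp
  also have "\<dots> = v \<bullet> (?A *\<^sub>v conjugate v)"
    by (rule symmetric_scalar_prod_mult[OF cA tA v(1) cv])
  also have "\<dots> = cnj z * (v \<bullet>c v)" unfolding Acv using v cv by simp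
  finally have "z = cnj z" using conjugate_square_eq_0_vec[OF v(1)] v(2) by simp
  then obtain e where e: "z = complex_of_real e" by (metis Reals_cases Reals_cnj_iff)
  \<comment> \<open>The real eigenvector is not extracted from \<open>v\<close>: \<open>e\<close> is
    a root of the real characteristic polynomial, hence an eigenvalue of \<open>A\<close>
    itself.\<close>
  have "poly (map_poly complex_of_real (char_poly A)) (complex_of_real e) = 0"
    using root e of_real_hom.char_poly_hom[OF A(1)] by metis
  then have "poly (char_poly A) e = 0" by (simp only: of_real_hom.poly_map_poly of_real_eq_0_iff)
  then have "eigenvalue A e" using eigenvalue_root_char_poly[OF A(1)] by simp
  then show ?thesis unfolding eigenvalue_def by blast
qed

text \<open>\<open>v\<close> is completed to a basis. Gram-Schmidt keeps the first vector and
  normalising only rescales it, hence the factor \<open>a\<close>. This is the change of basis for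
  the deflation below.\<close>

lemma orthogonal_mat_first_col:
  fixes v :: "real vec"
  assumes v: "v \<in> carrier_vec n" "v \<noteq> 0\<^sub>v n"
  shows "\<exists>W a. W \<in> carrier_mat n n \<and> transpose_mat W * W = 1\<^sub>m n \<and> col W 0 = a \<cdot>\<^sub>v v"
proof -
  interpret cof_vec_space n "TYPE(real)" .
  have n: "n > 0" using v by (cases n) auto
  define b where "b = basis_completion v"
  note b = basis_completion[OF v, folded b_def]
  define ws where "ws = gram_schmidt n b"
  from gram_schmidt_result[OF b(2,4,5) ws_def] b(6)
  have ws: "corthogonal ws" "set ws \<subseteq> carrier_vec n" "length ws = n" by auto
  obtain vs where "b = v # vs" using b(6,7) n by (cases b) auto
  then have hd: "hd ws = v" using gram_schmidt_hd[OF v(1)] unfolding ws_def by simp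
  have wc: "ws ! i \<in> carrier_vec n" if "i < n" for i using ws that by auto
  have co: "conjugate x = x" for x :: "real vec" by (intro eq_vecI) auto
  have orth: "ws ! i \<bullet> ws ! j = 0 \<longleftrightarrow> i \<noteq> j" if "i < n" "j < n" for i j
    using corthogonalD[OF ws(1), of i j] that ws(3) co by simp
  define W where "W = mat_of_cols n (map (\<lambda>w. (1 / vnorm w) \<cdot>\<^sub>v w) ws)"
  have W: "W \<in> carrier_mat n n" unfolding W_def using ws(3) by auto
  have colW: "col W i = (1 / vnorm (ws ! i)) \<cdot>\<^sub>v (ws ! i)" if "i < n" for i
    unfolding W_def using that ws wc[OF that] by (subst col_mat_of_cols) auto
  have "transpose_mat W * W = 1\<^sub>m n"
  proof (intro eq_matI)
    fix i j assume "i < dim_row (1\<^sub>m n)" "j < dim_col (1\<^sub>m n)"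
    then have ij: "i < n" "j < n" by auto
    have "(transpose_mat W * W) $$ (i,j) = col W i \<bullet> col W j" using W ij by simp
    also have "\<dots> = (1 / vnorm (ws ! i)) * (1 / vnorm (ws ! j)) * (ws ! i \<bullet> ws ! j)"
      unfolding colW[OF ij(1)] colW[OF ij(2)] using wc[OF ij(1)] wc[OF ij(2)] by simp
    also have "\<dots> = 1\<^sub>m n $$ (i,j)"
    proof (cases "i = j")
      case True
      have "ws ! i \<bullet> ws ! i \<noteq> 0" using orth[of i i] ij by simp
      then show ?thesis using True ij vnorm_sq[of "ws ! i"]
        by (simp add: power2_eq_square divide_simps) 
    qed (use orth ij in simp)
    finally show "(transpose_mat W * W) $$ (i,j) = 1\<^sub>m n $$ (i,j)" .
  qed (use W in auto)
  moreover have "ws ! 0 = v" using hd ws(3) n by (cases ws) auto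
  ultimately show ?thesis using W colW[OF n] by auto
qed

text \<open>Deflation: conjugating by an orthogonal matrix whose first column is an eigenvector
  clears the rest of the first column, symmetry clears the first row, and the induction hypothesis
  diagonalises the remaining block.\<close>

lemma real_symmetric_diagonalisation:
  fixes A :: "real mat"
  assumes "A \<in> carrier_mat n n" "transpose_mat A = A"
  shows "\<exists>U l. U \<in> carrier_mat n n \<and> transpose_mat U * U = 1\<^sub>m n \<and>
     transpose_mat U * A * U = mat n n (\<lambda>(i,j). if i = j then l i else 0)"
  using assms
proof (induction n arbitrary: A)
  case 0
  then show ?case by (intro exI[of _ "1\<^sub>m 0"]) (auto intro!: eq_matI)
next
  case (Suc n A)
  note A = Suc.prems
  obtain v e where "eigenvector A v e" using exists_real_eigenvector_symmetric[OF A] by auto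
  then have v: "v \<in> carrier_vec (Suc n)" "v \<noteq> 0\<^sub>v (Suc n)" "A *\<^sub>v v = e \<cdot>\<^sub>v v"
    using A unfolding eigenvector_def by auto
  obtain W a where W: "W \<in> carrier_mat (Suc n) (Suc n)" and WW: "transpose_mat W * W = 1\<^sub>m (Suc n)"
    and W0: "col W 0 = a \<cdot>\<^sub>v v" using orthogonal_mat_first_col[OF v(1,2)] by auto
  have tW: "transpose_mat W \<in> carrier_mat (Suc n) (Suc n)" using W by simp
  define B where "B = transpose_mat W * A * W"
  have B: "B \<in> carrier_mat (Suc n) (Suc n)" unfolding B_def using W A by auto
  have symB: "transpose_mat B = B"
    unfolding B_def using W A tW
    by (simp add: transpose_mult[of _ "Suc n" "Suc n" _ "Suc n"] assoc_mult_mat[of _ "Suc n" "Suc n" _ "Suc n" _ "Suc n"])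
  have AW0: "col (A * W) 0 = e \<cdot>\<^sub>v col W 0"
  proof -
    have "col (A * W) 0 = A *\<^sub>v col W 0" by (rule col_mult2[OF A(1) W]) simp
    also have "\<dots> = a \<cdot>\<^sub>v (A *\<^sub>v v)" unfolding W0 using A v by (simp add: mult_mat_vec)
    finally show ?thesis unfolding v(3) W0 by (simp add: smult_smult_assoc mult.commute)
  qed
  have B0: "B $$ (i,0) = (if i = 0 then e else 0)" if "i < Suc n" for i
  proof -
    have "B $$ (i,0) = (transpose_mat W * (A * W)) $$ (i,0)" unfolding B_def using W A tW
      by (simp add: assoc_mult_mat[of _ "Suc n" "Suc n" _ "Suc n" _ "Suc n"])
    also have "\<dots> = col W i \<bullet> col (A * W) 0" using that W A by auto
    also have "\<dots> = e * (transpose_mat W * W) $$ (i,0)" unfolding AW0 using that W by simp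
    finally show ?thesis unfolding WW using that by auto
  qed
  have B0': "B $$ (0,i) = (if i = 0 then e else 0)" if "i < Suc n" for i
  proof -
    have "B $$ (0,i) = transpose_mat B $$ (i,0)" using that B by (subst index_transpose_mat) auto
    then show ?thesis using B0[OF that] symB by simp
  qed
  define A3 where "A3 = mat n n (\<lambda>(i,j). B $$ (Suc i, Suc j))"
  have A3: "A3 \<in> carrier_mat n n" unfolding A3_def by auto
  have symA3: "transpose_mat A3 = A3"
  proof (intro eq_matI)
    fix i j assume "i < dim_row A3" "j < dim_col A3"
    then have ij: "i < n" "j < n" using A3 by auto
    have "transpose_mat A3 $$ (i,j) = transpose_mat B $$ (Suc i, Suc j)"
      using ij B unfolding A3_def by (simp)
    then show "transpose_mat A3 $$ (i,j) = A3 $$ (i,j)" using ij symB unfolding A3_def by simp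
  qed (use A3 in auto)
  define E where "E = mat 1 1 (\<lambda>_. e)"
  have E: "E \<in> carrier_mat 1 1" unfolding E_def by auto
  have Bblock: "B = four_block_mat E (0\<^sub>m 1 n) (0\<^sub>m n 1) A3"
    using B B0 B0' by (intro eq_matI) (auto simp: A3_def E_def)
  obtain U l where U: "U \<in> carrier_mat n n" "transpose_mat U * U = 1\<^sub>m n"
    "transpose_mat U * A3 * U = mat n n (\<lambda>(i,j). if i = j then l i else 0)"
    using Suc.IH[OF A3 symA3] by blast
  define Q where "Q = four_block_mat (1\<^sub>m 1) (0\<^sub>m 1 n) (0\<^sub>m n 1) U"
  have Q: "Q \<in> carrier_mat (Suc n) (Suc n)" unfolding Q_def using U
    using four_block_carrier_mat[OF one_carrier_mat[of 1] U(1)] by simp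
  have tQ: "transpose_mat Q = four_block_mat (1\<^sub>m 1) (0\<^sub>m 1 n) (0\<^sub>m n 1) (transpose_mat U)"
    unfolding Q_def using U by (subst transpose_four_block_mat[of _ 1 1 _ n _ n]) auto
  have tQc: "transpose_mat Q \<in> carrier_mat (Suc n) (Suc n)" using Q by simp
  have tU: "transpose_mat U \<in> carrier_mat n n" using U by simp
  have QQ: "transpose_mat Q * Q = 1\<^sub>m (Suc n)"
    unfolding tQ unfolding Q_def using U tU
    by (subst mult_four_block_mat[of _ 1 1 _ n _ n _ _ 1 _ n]) (auto intro!: eq_matI)
  have "transpose_mat Q * B = four_block_mat E (0\<^sub>m 1 n) (0\<^sub>m n 1) (transpose_mat U * A3)"
    unfolding tQ Bblock using tU A3 E
    by (subst mult_four_block_mat[of _ 1 1 _ n _ n _ _ 1 _ n]) auto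
  then have "transpose_mat Q * B * Q = four_block_mat E (0\<^sub>m 1 n) (0\<^sub>m n 1) (transpose_mat U * A3 * U)"
    unfolding Q_def using tU A3 U E
    by (simp, subst mult_four_block_mat[of _ 1 1 _ n _ n _ _ 1 _ n]) auto
  then have QBQ: "transpose_mat Q * B * Q =
     mat (Suc n) (Suc n) (\<lambda>(i,j). if i = j then (case i of 0 \<Rightarrow> e | Suc i \<Rightarrow> l i) else 0)"
    unfolding U(3) by (auto intro!: eq_matI simp: E_def split: nat.splits)
  have tWQ: "transpose_mat (W * Q) = transpose_mat Q * transpose_mat W"
    using W Q by (simp add: transpose_mult)
  have 1: "transpose_mat (W * Q) * (W * Q) = 1\<^sub>m (Suc n)"
  proof -
    have "transpose_mat (W * Q) * (W * Q) = transpose_mat Q * (transpose_mat W * W) * Q"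
      unfolding tWQ using W Q tW tQc by (simp add: assoc_mult_mat[of _ "Suc n" "Suc n" _ "Suc n" _ "Suc n"])
    then show ?thesis unfolding WW using QQ tQc by simp
  qed
  have 2: "transpose_mat (W * Q) * A * (W * Q) = transpose_mat Q * B * Q"
    unfolding tWQ B_def using W Q tW tQc A by (simp add: assoc_mult_mat[of _ "Suc n" "Suc n" _ "Suc n" _ "Suc n"])
  show ?case
    by (intro exI[of _ "W * Q"] exI[of _ "\<lambda>i. case i of 0 \<Rightarrow> e | Suc i \<Rightarrow> l i"] conjI 1)
      (use W Q 2 QBQ in auto)
qed

text \<open>The last clause is Parseval's identity; it encodes completeness of the
  \<open>u i\<close> and lets norms and quadratic forms be expanded directly as sums.\<close>

definition eigensystem :: "nat \<Rightarrow> real mat \<Rightarrow> (nat \<Rightarrow> real) \<Rightarrow> (nat \<Rightarrow> real vec) \<Rightarrow> bool" where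
  "eigensystem n M l u \<longleftrightarrow>
    (\<forall>i<n. u i \<in> carrier_vec n) \<and>
    (\<forall>i<n. M *\<^sub>v u i = l i \<cdot>\<^sub>v u i) \<and>
    (\<forall>i<n. \<forall>j<n. u i \<bullet> u j = (if i = j then 1 else 0)) \<and>
    (\<forall>x\<in>carrier_vec n. \<forall>y\<in>carrier_vec n. x \<bullet> y = (\<Sum>i<n. (x \<bullet> u i) * (y \<bullet> u i)))"

text \<open>The eigenvectors are the columns of the diagonalising matrix: orthonormality is
  \<open>U\<^sup>T U = 1\<close> and Parseval's identity is \<open>U U\<^sup>T = 1\<close>. The
  factorised characteristic polynomial later identifies the \<open>l i\<close> with its roots,
  multiplicities included.\<close>

lemma eigensystem_exists:
  assumes A: "A \<in> carrier_mat n n" "transpose_mat A = A"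
  shows "\<exists>l u. eigensystem n A l u \<and> char_poly A = (\<Prod>a\<leftarrow>map l [0..<n]. [:- a, 1:])"
proof -
  obtain U l where U: "U \<in> carrier_mat n n" "transpose_mat U * U = 1\<^sub>m n"
    and D: "transpose_mat U * A * U = mat n n (\<lambda>(i,j). if i = j then l i else 0)" (is "_ = ?D")
    using real_symmetric_diagonalisation[OF A] by auto
  have tU: "transpose_mat U \<in> carrier_mat n n" using U by simp
  have UU: "U * transpose_mat U = 1\<^sub>m n" using mat_mult_left_right_inverse[OF tU U(1,2)] .
  have "U * ?D = (U * transpose_mat U) * A * U" unfolding D[symmetric]
    using U tU A by (simp add: assoc_mult_mat[of _ n n _ n _ n])
  then have UD: "U * ?D = A * U" unfolding UU using A by simp
  have "A * (U * transpose_mat U) = U * ?D * transpose_mat U" unfolding UD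
    using U tU A by (simp add: assoc_mult_mat[of _ n n _ n _ n])
  then have "A = U * ?D * transpose_mat U" unfolding UU using A by simp
  then have "similar_mat_wit A ?D U (transpose_mat U)"
    using U UU A tU by (intro similar_mat_witI[of _ _ n]) auto
  then have "char_poly A = char_poly ?D" by (intro char_poly_similar) (auto simp: similar_mat_def)
  also have "\<dots> = (\<Prod>a\<leftarrow>diag_mat ?D. [:- a, 1:])"
    by (rule char_poly_upper_triangular[of _ n]) auto
  also have "diag_mat ?D = map l [0..<n]" unfolding diag_mat_def by (intro nth_equalityI) auto
  finally have cp: "char_poly A = (\<Prod>a\<leftarrow>map l [0..<n]. [:- a, 1:])" .
  have "eigensystem n A l (col U)"
    unfolding eigensystem_def
  proof (intro conjI allI impI ballI)
    fix i assume i: "i < n"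
    show "col U i \<in> carrier_vec n" using U i by auto
    have "A *\<^sub>v col U i = col (U * ?D) i" unfolding UD by (rule col_mult2[OF A(1) U(1) i, symmetric])
    also have "\<dots> = l i \<cdot>\<^sub>v col U i"
      using U i by (intro eq_vecI) (auto simp: scalar_prod_def if_distrib cong: if_cong)
    finally show "A *\<^sub>v col U i = l i \<cdot>\<^sub>v col U i" .
    fix j assume j: "j < n"
    have "col U i \<bullet> col U j = (transpose_mat U * U) $$ (i,j)" using U(1) i j by simp
    then show "col U i \<bullet> col U j = (if i = j then 1 else 0)" unfolding U(2) using i j by simp
  next
    fix x y :: "real vec" assume x: "x \<in> carrier_vec n" and y: "y \<in> carrier_vec n"
    have "(transpose_mat U *\<^sub>v x) \<bullet> (transpose_mat U *\<^sub>v y) = x \<bullet> ((U * transpose_mat U) *\<^sub>v y)"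
      using transpose_vec_mult_scalar[OF U(1), of "transpose_mat U *\<^sub>v y" x] x y U tU
      by (simp add: assoc_mult_mat_vec[of _ n n _ n])
    then have "x \<bullet> y = (transpose_mat U *\<^sub>v x) \<bullet> (transpose_mat U *\<^sub>v y)" unfolding UU using y by simp
    also have "\<dots> = (\<Sum>i<n. (col U i \<bullet> x) * (col U i \<bullet> y))"
      unfolding scalar_prod_def[of "transpose_mat U *\<^sub>v x"] using U x y
      by (auto intro!: sum.cong simp: lessThan_atLeast0)
    also have "\<dots> = (\<Sum>i<n. (x \<bullet> col U i) * (y \<bullet> col U i))"
      using x y U by (intro sum.cong refl) (simp add: comm_scalar_prod[of _ n])
    finally show "x \<bullet> y = (\<Sum>i<n. (x \<bullet> col U i) * (y \<bullet> col U i))" .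
  qed
  then show ?thesis using cp by blast
qed

text \<open>The list under the square root in \<open>sing_val\<close>, but indexed from 0 and for a
  general matrix.\<close>

definition eigvals_desc :: "real mat \<Rightarrow> real list" where
  "eigvals_desc A = rev (sorted_list_of_multiset (proots (char_poly A)))"

text \<open>As multisets, the roots of the characteristic polynomial and the \<open>l i\<close>
  coincide, so the descending list rearranges \<open>l\<close> by some permutation \<open>p\<close>;
  the eigenvectors are permuted along with it.\<close>

lemma eigensystem_exists_sorted:
  assumes A: "A \<in> carrier_mat n n" "transpose_mat A = A"
  shows "\<exists>u. eigensystem n A ((!) (eigvals_desc A)) u" and "length (eigvals_desc A) = n"
proof -
  obtain l u where lu: "eigensystem n A l u" "char_poly A = (\<Prod>a\<leftarrow>map l [0..<n]. [:- a, 1:])"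
    using eigensystem_exists[OF A] by auto
  have "proots (\<Prod>a\<leftarrow>xs. [:- a, 1:]) = mset xs" for xs :: "real list"
  proof (induction xs)
    case (Cons a xs)
    have "(\<Prod>a\<leftarrow>xs. [:- a, 1:]) \<noteq> 0"
      unfolding prod_list_zero_iff by auto
    then have "proots ([:- a, 1:] * (\<Prod>a\<leftarrow>xs. [:- a, 1:])) = {#a#} + mset xs"
      using Cons.IH by (subst proots_mult) auto
    then show ?case by simp
  qed simp
  then have "proots (char_poly A) = mset (map l [0..<n])" unfolding lu(2) .
  then have m: "mset (eigvals_desc A) = mset (map l [0..<n])" unfolding eigvals_desc_def by simp
  from mset_eq_length[OF m] show len: "length (eigvals_desc A) = n" by simp
  from mset_eq_permutation[OF m] obtain p where p: "p permutes {..<n}"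
    and pe: "permute_list p (map l [0..<n]) = eigvals_desc A" by auto
  have nth: "eigvals_desc A ! i = l (p i)" if "i < n" for i
    unfolding pe[symmetric] using permutes_in_image[OF p, of i] that p by (simp add: permute_list_nth)
  have pin: "p i < n" if "i < n" for i using permutes_in_image[OF p, of i] that by simp
  have pinj: "p i = p j \<longleftrightarrow> i = j" for i j using permutes_inj[OF p] by (simp add: inj_eq)
  have reidx: "(\<Sum>i<n. f (p i)) = (\<Sum>i<n. f i)" for f :: "nat \<Rightarrow> real"
    using sum.permute[OF p, of f] by (simp add: o_def)
  have esD: "u i \<in> carrier_vec n" "A *\<^sub>v u i = l i \<cdot>\<^sub>v u i"
    "u i \<bullet> u j = (if i = j then 1 else 0)" if "i < n" "j < n" for i j
    using lu(1) that unfolding eigensystem_def by blast+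
  have "eigensystem n A ((!) (eigvals_desc A)) (u \<circ> p)"
    unfolding eigensystem_def
  proof (intro conjI allI impI ballI)
    fix x y :: "real vec" assume xy: "x \<in> carrier_vec n" "y \<in> carrier_vec n"
    have "x \<bullet> y = (\<Sum>i<n. (x \<bullet> u i) * (y \<bullet> u i))" using lu(1) xy unfolding eigensystem_def by blast
    then show "x \<bullet> y = (\<Sum>i<n. (x \<bullet> (u \<circ> p) i) * (y \<bullet> (u \<circ> p) i))"
      using reidx[of "\<lambda>i. (x \<bullet> u i) * (y \<bullet> u i)"] by simp
  qed (simp_all add: esD nth pin pinj)
  then show "\<exists>u. eigensystem n A ((!) (eigvals_desc A)) u" by blast
qed

lemma eigvals_desc_mono:
  "i \<le> j \<Longrightarrow> j < length (eigvals_desc A) \<Longrightarrow> eigvals_desc A ! j \<le> eigvals_desc A ! i"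
  unfolding eigvals_desc_def
  using sorted_wrt_rev by (simp add: rev_nth sorted_nth_mono)

section \<open>Low-rank approximation from a perturbed Gram matrix\<close>

lemma eigensystemD:
  assumes "eigensystem n A l u"
  shows "i < n \<Longrightarrow> u i \<in> carrier_vec n" "i < n \<Longrightarrow> A *\<^sub>v u i = l i \<cdot>\<^sub>v u i"
    "i < n \<Longrightarrow> j < n \<Longrightarrow> u i \<bullet> u j = (if i = j then 1 else 0)"
    "x \<in> carrier_vec n \<Longrightarrow> y \<in> carrier_vec n \<Longrightarrow> x \<bullet> y = (\<Sum>i<n. (x \<bullet> u i) * (y \<bullet> u i))"
  using assms unfolding eigensystem_def by blast+

lemma eigensystem_mult_scalar_prod:
  assumes A: "A \<in> carrier_mat n n" "transpose_mat A = A" and es: "eigensystem n A l u"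
    and x: "x \<in> carrier_vec n" and i: "i < n"
  shows "(A *\<^sub>v x) \<bullet> u i = l i * (x \<bullet> u i)"
  using symmetric_scalar_prod_mult[OF A x eigensystemD(1)[OF es i]] eigensystemD(1,2)[OF es i] x by simp

lemma eigensystem_quadratic_form:
  assumes A: "A \<in> carrier_mat n n" "transpose_mat A = A" and es: "eigensystem n A l u"
    and x: "x \<in> carrier_vec n"
  shows "(A *\<^sub>v x) \<bullet> x = (\<Sum>i<n. l i * (x \<bullet> u i)\<^sup>2)"
proof -
  have "(A *\<^sub>v x) \<bullet> x = (\<Sum>i<n. ((A *\<^sub>v x) \<bullet> u i) * (x \<bullet> u i))"
    using A x by (intro eigensystemD(4)[OF es]) auto
  also have "\<dots> = (\<Sum>i<n. l i * (x \<bullet> u i)\<^sup>2)"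
    by (intro sum.cong refl) (simp add: eigensystem_mult_scalar_prod[OF A es x] power2_eq_square)
  finally show ?thesis .
qed

lemma eigensystem_norm:
  assumes "eigensystem n A l u" "x \<in> carrier_vec n"
  shows "x \<bullet> x = (\<Sum>i<n. (x \<bullet> u i)\<^sup>2)"
  using eigensystemD(4)[OF assms(1) assms(2) assms(2)] by (simp add: power2_eq_square)

lemma gram_mat:
  fixes A :: "real mat"
  assumes "A \<in> carrier_mat m n"
  shows "transpose_mat A * A \<in> carrier_mat n n" "transpose_mat (transpose_mat A * A) = transpose_mat A * A"
    "x \<in> carrier_vec n \<Longrightarrow> ((transpose_mat A * A) *\<^sub>v x) \<bullet> x = (A *\<^sub>v x) \<bullet> (A *\<^sub>v x)"
proof -
  show "transpose_mat A * A \<in> carrier_mat n n" using assms by auto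
  show "transpose_mat (transpose_mat A * A) = transpose_mat A * A"
    using assms by (simp add: transpose_mult[of _ n m _ n])
  assume x: "x \<in> carrier_vec n"
  show "((transpose_mat A * A) *\<^sub>v x) \<bullet> x = (A *\<^sub>v x) \<bullet> (A *\<^sub>v x)"
    using assms x transpose_vec_mult_scalar[OF assms x, of "A *\<^sub>v x"]
    by (simp add: assoc_mult_mat_vec[of _ n m _ n] comm_scalar_prod[of _ n])
qed

text \<open>For a family orthogonal with respect to \<open>M\<close> the form is diagonal in the
  coefficients. It is used with the identity for norms and with a Gram matrix for Rayleigh
  quotients.\<close>

lemma quadratic_form_mat_of_cols:
  fixes M :: "real mat"
  assumes M: "M \<in> carrier_mat n n" and w: "\<And>i. i < N \<Longrightarrow> w i \<in> carrier_vec n"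
    and q: "\<And>i k. i < N \<Longrightarrow> k < N \<Longrightarrow> w i \<bullet> (M *\<^sub>v w k) = (if i = k then q i else 0)"
    and a: "a \<in> carrier_vec N"
  defines "W \<equiv> mat_of_cols n (map w [0..<N])"
  shows "(W *\<^sub>v a) \<bullet> (M *\<^sub>v (W *\<^sub>v a)) = (\<Sum>i<N. q i * (a $ i)\<^sup>2)"
proof -
  have W: "W \<in> carrier_mat n N" unfolding W_def by auto
  have colW: "col W i = w i" if "i < N" for i
    unfolding W_def using that w by (subst col_mat_of_cols) auto
  have e: "transpose_mat W * (M * W) = mat N N (\<lambda>(i,k). if i = k then q i else 0)"
  proof (intro eq_matI)
    fix i k assume "i < dim_row (mat N N (\<lambda>(i,k). if i = k then q i else 0))"
      "k < dim_col (mat N N (\<lambda>(i,k). if i = k then q i else 0))"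
    then have ik: "i < N" "k < N" by auto
    have "(transpose_mat W * (M * W)) $$ (i,k) = col W i \<bullet> col (M * W) k" using W M ik by simp
    also have "\<dots> = w i \<bullet> (M *\<^sub>v w k)" unfolding col_mult2[OF M W ik(2)] using ik colW by simp
    finally show "(transpose_mat W * (M * W)) $$ (i,k) = mat N N (\<lambda>(i,k). if i = k then q i else 0) $$ (i,k)"
      using q ik by simp
  qed (use W M in auto)
  have "(W *\<^sub>v a) \<bullet> (M *\<^sub>v (W *\<^sub>v a)) = (M *\<^sub>v (W *\<^sub>v a)) \<bullet> (W *\<^sub>v a)"
    using W M a by (simp add: comm_scalar_prod[of _ n])
  also have "\<dots> = (transpose_mat W *\<^sub>v (M *\<^sub>v (W *\<^sub>v a))) \<bullet> a"
    using transpose_vec_mult_scalar[OF W a, of "M *\<^sub>v (W *\<^sub>v a)"] W M a by simp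
  also have "transpose_mat W *\<^sub>v (M *\<^sub>v (W *\<^sub>v a)) = (transpose_mat W * (M * W)) *\<^sub>v a"
    using W M a by (simp add: assoc_mult_mat_vec[of _ N n _ N] assoc_mult_mat_vec[of _ n n _ N])
  also have "\<dots> \<bullet> a = (\<Sum>i<N. q i * (a $ i)\<^sup>2)" unfolding e using a
    by (simp add: scalar_prod_def lessThan_atLeast0 if_distrib if_distribR power2_eq_square mult.assoc cong: if_cong)
  finally show ?thesis .
qed

text \<open>One half of the Courant--Fischer principle: a \<open>(j + 1)\<close>-dimensional range of \<open>W\<close> meets the
  span of all eigenvectors except the first \<open>j\<close>.\<close>

lemma eigval_ge_of_rayleigh:
  assumes A: "A \<in> carrier_mat n n" "transpose_mat A = A"
    and W: "W \<in> carrier_mat n (Suc j)"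
    and inj: "\<And>a. a \<in> carrier_vec (Suc j) \<Longrightarrow> W *\<^sub>v a = 0\<^sub>v n \<Longrightarrow> a = 0\<^sub>v (Suc j)"
    and ray: "\<And>a. a \<in> carrier_vec (Suc j) \<Longrightarrow>
      (A *\<^sub>v (W *\<^sub>v a)) \<bullet> (W *\<^sub>v a) \<ge> \<rho> * ((W *\<^sub>v a) \<bullet> (W *\<^sub>v a))"
  shows "j < n \<and> \<rho> \<le> eigvals_desc A ! j"
proof -
  obtain u where es: "eigensystem n A ((!) (eigvals_desc A)) u" and len: "length (eigvals_desc A) = n"
    using eigensystem_exists_sorted[OF A] by auto
  \<comment> \<open>The first \<open>j\<close> rows of \<open>N\<close> express orthogonality of
    \<open>W *\<^sub>v a\<close> to the first \<open>j\<close> eigenvectors, and the zero row makes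
    the square system singular. The guard \<open>i < n\<close> is there because \<open>j < n\<close>
    is established only below.\<close>
  define c where "c i = vec (Suc j) (\<lambda>k. if i < n then col W k \<bullet> u i else 0)" for i
  define N where "N = mat\<^sub>r (Suc j) (Suc j) (\<lambda>i. if i = j then 0\<^sub>v (Suc j) else c i)"
  have N: "N \<in> carrier_mat (Suc j) (Suc j)" unfolding N_def by auto
  have "det N = 0" unfolding N_def by (rule det_row_0) (auto simp: c_def)
  then obtain a where a: "a \<in> carrier_vec (Suc j)" "a \<noteq> 0\<^sub>v (Suc j)" "N *\<^sub>v a = 0\<^sub>v (Suc j)"
    using det_0_iff_vec_prod_zero[OF N] by auto
  define x where "x = W *\<^sub>v a"
  have x: "x \<in> carrier_vec n" unfolding x_def using W a by simp
  have "x \<noteq> 0\<^sub>v n" using inj[OF a(1)] a(2) unfolding x_def by auto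
  then have xx: "x \<bullet> x > 0" using scalar_prod_self_eq_0_iff[OF x] scalar_prod_ge_0_real[of x] by simp
  have orth: "x \<bullet> u i = 0" if i: "i < min j n" for i
  proof -
    have ui: "u i \<in> carrier_vec n" using eigensystemD(1)[OF es] i by simp
    have "x \<bullet> u i = a \<bullet> (transpose_mat W *\<^sub>v u i)"
      unfolding x_def using transpose_vec_mult_scalar[OF W a(1) ui] W a ui
      by (simp add: comm_scalar_prod[of _ n] comm_scalar_prod[of _ "Suc j"])
    also have "\<dots> = row N i \<bullet> a"
      using a i W ui by (subst comm_scalar_prod[OF a(1)]) (auto simp: N_def c_def scalar_prod_def intro!: sum.cong)
    also have "\<dots> = (N *\<^sub>v a) $ i" using N i by simp
    finally show ?thesis unfolding a(3) using i by simp
  qed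
  have "j < n"
  proof (rule ccontr)
    assume "\<not> j < n"
    then have "x \<bullet> x = 0" using eigensystem_norm[OF es x] orth by simp
    then show False using xx by simp
  qed
  have "\<rho> * (x \<bullet> x) \<le> (A *\<^sub>v x) \<bullet> x" using ray[OF a(1)] unfolding x_def .
  also have "\<dots> = (\<Sum>i<n. eigvals_desc A ! i * (x \<bullet> u i)\<^sup>2)"
    by (rule eigensystem_quadratic_form[OF A es x])
  also have "\<dots> \<le> (\<Sum>i<n. eigvals_desc A ! j * (x \<bullet> u i)\<^sup>2)"
  proof (intro sum_mono)
    fix i assume "i \<in> {..<n}"
    then show "eigvals_desc A ! i * (x \<bullet> u i)\<^sup>2 \<le> eigvals_desc A ! j * (x \<bullet> u i)\<^sup>2"
      using orth[of i] eigvals_desc_mono[of j i A] len by (cases "i < j") (auto intro!: mult_right_mono)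
  qed
  also have "\<dots> = eigvals_desc A ! j * (x \<bullet> x)"
    unfolding eigensystem_norm[OF es x] by (simp add: sum_distrib_left)
  finally show ?thesis using xx \<open>j < n\<close> by simp
qed

section \<open>Singular values as roots of Gram eigenvalues\<close>

lemma eigvals_desc_gram_nonneg:
  assumes "A \<in> carrier_mat m n" "i < n"
  shows "0 \<le> eigvals_desc (transpose_mat A * A) ! i"
proof -
  obtain u where es: "eigensystem n (transpose_mat A * A) ((!) (eigvals_desc (transpose_mat A * A))) u"
    using eigensystem_exists_sorted(1)[OF gram_mat(1,2)[OF assms(1)]] by auto
  have ui: "u i \<in> carrier_vec n" using eigensystemD(1)[OF es assms(2)] .
  have "eigvals_desc (transpose_mat A * A) ! i = ((transpose_mat A * A) *\<^sub>v u i) \<bullet> u i"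
    using eigensystemD(2)[OF es assms(2)] eigensystemD(3)[OF es assms(2) assms(2)] ui by simp
  also have "\<dots> \<ge> 0" unfolding gram_mat(3)[OF assms(1) ui] by (rule scalar_prod_ge_0_real)
  finally show ?thesis .
qed

text \<open>\<open>sing_val\<close> counts from 1 and \<open>eigvals_desc\<close> from 0. Squaring
  undoes the root because Gram eigenvalues are nonnegative.\<close>

lemma sing_val_sq:
  assumes "A \<in> carrier_mat m n" "i < n"
  shows "(sing_val A (i + 1))\<^sup>2 = eigvals_desc (transpose_mat A * A) ! i"
  using assms eigvals_desc_gram_nonneg[OF assms] unfolding sing_val_def eigvals_desc_def by auto

lemma sing_val_nonneg:
  assumes "A \<in> carrier_mat m n"
  shows "0 \<le> sing_val A i"
  using assms eigvals_desc_gram_nonneg[OF assms, of "i - 1"] unfolding sing_val_def eigvals_desc_def by auto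

lemma sing_val_antimono:
  assumes A: "A \<in> carrier_mat m n" and ij: "1 \<le> i" "i \<le> j"
  shows "sing_val A j \<le> sing_val A i"
proof (cases "j \<le> n")
  case True
  then show ?thesis
    using A ij eigvals_desc_mono[of "i - 1" "j - 1" "transpose_mat A * A"]
      eigensystem_exists_sorted(2)[OF gram_mat(1,2)[OF A]]
    unfolding sing_val_def eigvals_desc_def by auto
next
  case False
  then show ?thesis using A sing_val_nonneg[OF A, of i] unfolding sing_val_def by auto
qed

text \<open>With positivity of singular values as \<open>Q\<close>, this turns the cardinality
  \<open>k'\<close> of \<open>is_top_proj\<close> into a cut-off index.\<close>

lemma initial_segment_eq_card:
  assumes "\<And>i j. 1 \<le> i \<Longrightarrow> i \<le> j \<Longrightarrow> Q j \<Longrightarrow> Q i"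
  shows "{i \<in> {1..k}. Q i} = {1..card {i \<in> {1..k::nat}. Q i}}"
proof (induction k)
  case (Suc k)
  show ?case
  proof (cases "Q (Suc k)")
    case True
    then have "{i \<in> {1..Suc k}. Q i} = {1..Suc k}" using assms[of _ "Suc k"] by auto
    then show ?thesis by simp
  next
    case False
    then have "{i \<in> {1..Suc k}. Q i} = {i \<in> {1..k}. Q i}" by (auto simp: le_Suc_eq)
    then show ?thesis using Suc by simp
  qed
qed simp

text \<open>Let \<open>\<mu>\<close> be the Rayleigh quotient of \<open>y\<close> for the Gram matrix of \<open>At\<close>. Spans of
  \<open>v 0, \<dots>, v (j - 1), y\<close> have Rayleigh quotients at least \<open>\<mu>\<close>; inductively this forces all
  eigenvalues of the \<open>v i\<close> to be at least \<open>\<mu>\<close>, and then the span with \<open>j = k'\<close> bounds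
  \<open>\<kappa> * \<mu> - \<eta>\<close> by the eigenvalue of \<open>A\<^sup>T A\<close> with index \<open>k\<close>.\<close>

lemma top_proj_quadratic_bound:
  assumes A: "A \<in> carrier_mat m n" and At: "At \<in> carrier_mat d n" and \<kappa>: "0 \<le> \<kappa>" and \<eta>: "0 \<le> \<eta>"
    and close: "\<And>y. y \<in> carrier_vec n \<Longrightarrow>
      \<bar>(A *\<^sub>v y) \<bullet> (A *\<^sub>v y) - \<kappa> * ((At *\<^sub>v y) \<bullet> (At *\<^sub>v y))\<bar> \<le> \<eta> * (y \<bullet> y)"
    and k': "k' = card {i \<in> {1..k}. sing_val At i > 0}"
    and v: "\<And>i. i < k' \<Longrightarrow> v i \<in> carrier_vec n"
    and ev: "\<And>i. i < k' \<Longrightarrow> (transpose_mat At * At) *\<^sub>v v i = (sing_val At (i + 1))\<^sup>2 \<cdot>\<^sub>v v i"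
    and vv: "\<And>i j. i < k' \<Longrightarrow> j < k' \<Longrightarrow> v i \<bullet> v j = (if i = j then 1 else 0)"
    and y: "y \<in> carrier_vec n" "\<And>i. i < k' \<Longrightarrow> v i \<bullet> y = 0"
  shows "(A *\<^sub>v y) \<bullet> (A *\<^sub>v y) \<le> ((sing_val A (k + 1))\<^sup>2 + 2 * \<eta>) * (y \<bullet> y)"
proof (cases "y = 0\<^sub>v n")
  case True
  have "A *\<^sub>v 0\<^sub>v n = 0\<^sub>v m" using A by (intro eq_vecI) auto
  then show ?thesis using True by simp
next
  case False
  let ?G = "transpose_mat At * At" and ?B = "transpose_mat A * A"
  note G = gram_mat[OF At] and B = gram_mat[OF A]
  have yy: "y \<bullet> y > 0" using False scalar_prod_self_eq_0_iff[OF y(1)] scalar_prod_ge_0_real[of y] by simp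
  define \<mu> where "\<mu> = ((At *\<^sub>v y) \<bullet> (At *\<^sub>v y)) / (y \<bullet> y)"
  have \<mu>: "(At *\<^sub>v y) \<bullet> (At *\<^sub>v y) = \<mu> * (y \<bullet> y)" unfolding \<mu>_def using yy by simp
  have yAy: "(A *\<^sub>v y) \<bullet> (A *\<^sub>v y) \<le> (\<kappa> * \<mu> + \<eta>) * (y \<bullet> y)"
    using close[OF y(1)] unfolding \<mu> by (simp add: algebra_simps)
  have seg: "{i \<in> {1..k}. sing_val At i > 0} = {1..k'}" unfolding k'
    using sing_val_antimono[OF At] by (intro initial_segment_eq_card) (meson less_le_trans)
  have k'k: "k' \<le> k" 
  proof -
    have "{1..k'} \<subseteq> {1..k}" using seg by blast
    then show ?thesis using card_mono[of "{1..k}" "{1..k'}"] by simp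
  qed
  define w where "w j i = (if i < j then v i else y)" for j i :: nat
  define W where "W j = mat_of_cols n (map (w j) [0..<Suc j])" for j
  have Wc: "W j \<in> carrier_mat n (Suc j)" for j unfolding W_def by auto
  have wc: "w j i \<in> carrier_vec n" if "j \<le> k'" for i j using that v y unfolding w_def by auto
  have ww: "(W j *\<^sub>v a) \<bullet> (W j *\<^sub>v a) = (\<Sum>i<Suc j. (if i < j then 1 else y \<bullet> y) * (a $ i)\<^sup>2)"
    if "j \<le> k'" and a: "a \<in> carrier_vec (Suc j)" for j a
  proof -
    have "(W j *\<^sub>v a) \<bullet> (1\<^sub>m n *\<^sub>v (W j *\<^sub>v a)) = (\<Sum>i<Suc j. (if i < j then 1 else y \<bullet> y) * (a $ i)\<^sup>2)"
      unfolding W_def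
    proof (rule quadratic_form_mat_of_cols[OF _ wc[OF that(1)] _ a])
      fix i k assume ik: "i < Suc j" "k < Suc j"
      have yv: "y \<bullet> v i = 0" if "i < k'" for i
        using y that v[OF that] by (simp add: comm_scalar_prod[of y n])
      show "w j i \<bullet> (1\<^sub>m n *\<^sub>v w j k) = (if i = k then if i < j then 1 else y \<bullet> y else 0)"
        using ik that(1) wc[OF that(1), of k] vv[of i k] y(2)[of i] yv[of k] unfolding w_def
        by (auto split: if_splits)
    qed auto
    then show ?thesis using Wc[of j] a by simp
  qed
  have inj: "a = 0\<^sub>v (Suc j)" if "j \<le> k'" and a: "a \<in> carrier_vec (Suc j)" and "W j *\<^sub>v a = 0\<^sub>v n" for j a
  proof -
    have "(\<Sum>i<Suc j. (if i < j then 1 else y \<bullet> y) * (a $ i)\<^sup>2) = 0"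
      using ww[OF that(1) a] that(3) by simp
    then have "\<forall>i\<in>{..<Suc j}. (if i < j then 1 else y \<bullet> y) * (a $ i)\<^sup>2 = 0"
      using yy by (subst (asm) sum_nonneg_eq_0_iff) auto
    then show ?thesis using a yy by (intro eq_vecI) (auto split: if_splits)
  qed
  \<comment> \<open>In the family \<open>w j\<close> both the norm and the form of \<open>?G\<close>
    are diagonal, so the inequality is checked coefficient by coefficient.\<close>
  have rayG: "(?G *\<^sub>v (W j *\<^sub>v a)) \<bullet> (W j *\<^sub>v a) \<ge> \<mu> * ((W j *\<^sub>v a) \<bullet> (W j *\<^sub>v a))"
    if j: "j \<le> k'" "\<And>i. i < j \<Longrightarrow> \<mu> \<le> (sing_val At (i + 1))\<^sup>2" and a: "a \<in> carrier_vec (Suc j)" for j a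
  proof -
    have Wa: "W j *\<^sub>v a \<in> carrier_vec n" using Wc[of j] a by simp
    have vGy: "v i \<bullet> (?G *\<^sub>v y) = 0" if "i < k'" for i
      using symmetric_scalar_prod_mult[OF G(1,2) v[OF that] y(1)] ev[OF that] v[OF that] y(1) y(2)[OF that] by simp
    have yv: "y \<bullet> v i = 0" if "i < k'" for i
      using y that v[OF that] by (simp add: comm_scalar_prod[of y n])
    have vGy': "y \<bullet> (?G *\<^sub>v v i) = 0" if "i < k'" for i
      unfolding ev[OF that] using yv[OF that] v[OF that] y(1) by simp
    have vGv: "v i \<bullet> (?G *\<^sub>v v k) = (if i = k then (sing_val At (i + 1))\<^sup>2 else 0)"
      if "i < k'" "k < k'" for i k
      unfolding ev[OF that(2)] using vv[OF that] v[OF that(1)] v[OF that(2)] by simp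
    have yGy: "y \<bullet> (?G *\<^sub>v y) = \<mu> * (y \<bullet> y)"
      using G(3)[OF y(1)] \<mu> symmetric_scalar_prod_mult[OF G(1,2) y(1) y(1)] by simp
    have "(W j *\<^sub>v a) \<bullet> (?G *\<^sub>v (W j *\<^sub>v a)) =
        (\<Sum>i<Suc j. (if i < j then (sing_val At (i + 1))\<^sup>2 else \<mu> * (y \<bullet> y)) * (a $ i)\<^sup>2)"
      unfolding W_def
    proof (rule quadratic_form_mat_of_cols[OF G(1) wc[OF j(1)] _ a])
      fix i k assume ik: "i < Suc j" "k < Suc j"
      show "w j i \<bullet> (?G *\<^sub>v w j k) = (if i = k then if i < j then (sing_val At (i + 1))\<^sup>2 else \<mu> * (y \<bullet> y) else 0)"
        using ik j(1) vGv[of i k] vGy[of i] vGy'[of k] yGy unfolding w_def by auto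
    qed
    moreover have "\<mu> * ((W j *\<^sub>v a) \<bullet> (W j *\<^sub>v a)) \<le>
        (\<Sum>i<Suc j. (if i < j then (sing_val At (i + 1))\<^sup>2 else \<mu> * (y \<bullet> y)) * (a $ i)\<^sup>2)"
      unfolding ww[OF j(1) a] sum_distrib_left mult.assoc[symmetric]
      using j(2) by (intro sum_mono mult_right_mono) auto
    ultimately show ?thesis using symmetric_scalar_prod_mult[OF G(1,2) Wa Wa] by simp
  qed
  have maxminG: "j < n \<and> \<mu> \<le> eigvals_desc ?G ! j"
    if j: "j \<le> k'" "\<And>i. i < j \<Longrightarrow> \<mu> \<le> (sing_val At (i + 1))\<^sup>2" for j
    using inj[OF j(1)] rayG[OF j] by (intro eigval_ge_of_rayleigh[OF G(1,2) Wc]) auto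
  have top: "\<mu> \<le> (sing_val At (i + 1))\<^sup>2" if "i < k'" for i
    using that
  proof (induction i rule: less_induct)
    case (less i)
    then have "i < n \<and> \<mu> \<le> eigvals_desc ?G ! i" by (intro maxminG) auto
    then show ?case using sing_val_sq[OF At, of i] by simp
  qed
  show ?thesis
  proof (cases "k' = k")
    case True
    have "k < n \<and> \<kappa> * \<mu> - \<eta> \<le> eigvals_desc ?B ! k"
    proof (rule eigval_ge_of_rayleigh[OF B(1,2) Wc])
      fix a :: "real vec" assume a: "a \<in> carrier_vec (Suc k)"
      then show "W k *\<^sub>v a = 0\<^sub>v n \<Longrightarrow> a = 0\<^sub>v (Suc k)" using inj[of k a] True by simp
      let ?x = "W k *\<^sub>v a"
      have x: "?x \<in> carrier_vec n" using Wc[of k] a by simp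
      have "\<mu> * (?x \<bullet> ?x) \<le> (At *\<^sub>v ?x) \<bullet> (At *\<^sub>v ?x)"
        using rayG[of k a] top True a G(3)[OF x] by simp
      then have "\<kappa> * (\<mu> * (?x \<bullet> ?x)) \<le> \<kappa> * ((At *\<^sub>v ?x) \<bullet> (At *\<^sub>v ?x))"
        by (rule mult_left_mono[OF _ \<kappa>])
      then show "(\<kappa> * \<mu> - \<eta>) * (?x \<bullet> ?x) \<le> (?B *\<^sub>v ?x) \<bullet> ?x"
        unfolding B(3)[OF x] using close[OF x] by (simp add: algebra_simps)
    qed
    \<comment> \<open>The error \<open>\<eta>\<close> enters twice: in \<open>yAy\<close> for
      \<open>y\<close> itself, and here for the range of \<open>W k\<close>.\<close>
    then have "\<kappa> * \<mu> + \<eta> \<le> (sing_val A (k + 1))\<^sup>2 + 2 * \<eta>" using sing_val_sq[OF A, of k] by simp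
    then show ?thesis using order_trans[OF yAy mult_right_mono] yy by simp
  next
    case False
    \<comment> \<open>For \<open>k' < k\<close> the next singular value of \<open>At\<close> is 0.
      The max-min bound with \<open>j = k'\<close> then forces \<open>\<mu> \<le> 0\<close>, leaving
      only the error \<open>\<eta>\<close>.\<close>
    then have "k' + 1 \<in> {1..k}" "k' + 1 \<notin> {1..k'}" using k'k by auto
    then have "\<not> sing_val At (k' + 1) > 0" using seg by blast
    then have "sing_val At (k' + 1) = 0" using sing_val_nonneg[OF At, of "k' + 1"] by simp
    moreover have "k' < n \<and> \<mu> \<le> eigvals_desc ?G ! k'" using top by (intro maxminG) auto
    ultimately have "\<mu> \<le> 0" using sing_val_sq[OF At, of k'] by simp
    then have "\<kappa> * \<mu> \<le> 0" using \<kappa> by (simp add: mult_nonneg_nonpos)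
    then have "\<kappa> * \<mu> + \<eta> \<le> (sing_val A (k + 1))\<^sup>2 + 2 * \<eta>" using \<eta> zero_le_power2[of "sing_val A (k + 1)"] by linarith
    then show ?thesis using order_trans[OF yAy mult_right_mono] yy by simp
  qed
qed

section \<open>From quadratic forms to the spectral norm\<close>

lemma spec_norm_le:
  assumes "\<And>x. x \<in> carrier_vec (dim_col M) \<Longrightarrow> vnorm x \<le> 1 \<Longrightarrow> vnorm (M *\<^sub>v x) \<le> K"
  shows "spec_norm M \<le> K"
  unfolding spec_norm_def
proof (rule cSup_least)
  have "vnorm (0\<^sub>v (dim_col M)) \<le> 1" unfolding vnorm_def by simp
  then show "{vnorm (M *\<^sub>v x) |x. x \<in> carrier_vec (dim_col M) \<and> vnorm x \<le> 1} \<noteq> {}"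
    using zero_carrier_vec by blast
qed (use assms in auto)

text \<open>With \<open>y = x - P x\<close> one has \<open>(A - A P) x = A y\<close>, where
  \<open>y\<close> is orthogonal to the selected eigenvectors and no longer than \<open>x\<close>;
  so \<open>top_proj_quadratic_bound\<close> applies. The last step is
  \<open>s\<^sup>2 + 2 \<eta> \<le> (s + sqrt (2 \<eta>))\<^sup>2\<close> for
  \<open>s \<ge> 0\<close>.\<close>

lemma top_proj_spec_norm_bound:
  assumes A: "A \<in> carrier_mat m n" and At: "At \<in> carrier_mat d n" and \<kappa>: "0 \<le> \<kappa>" and \<eta>: "0 \<le> \<eta>"
    and close: "\<And>y. y \<in> carrier_vec n \<Longrightarrow>
      \<bar>(A *\<^sub>v y) \<bullet> (A *\<^sub>v y) - \<kappa> * ((At *\<^sub>v y) \<bullet> (At *\<^sub>v y))\<bar> \<le> \<eta> * (y \<bullet> y)"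
    and P: "is_top_proj At k P"
  shows "spec_norm (A - A * P) \<le> sing_val A (k + 1) + sqrt (2 * \<eta>)"
proof -
  define k' where "k' = card {i \<in> {1..k}. sing_val At i > 0}"
  obtain vs where vs: "length vs = k'"
    "\<And>i. i < k' \<Longrightarrow> eigenvector (transpose_mat At * At) (vs ! i) ((sing_val At (i + 1))\<^sup>2)"
    "\<And>i j. i < k' \<Longrightarrow> j < k' \<Longrightarrow> (vs ! i) \<bullet> (vs ! j) = (if i = j then 1 else 0)"
    "P = mat n n (\<lambda>(a, b). \<Sum>i<k'. (vs ! i) $ a * (vs ! i) $ b)"
    using P At unfolding is_top_proj_def Let_def k'_def by auto
  have v: "vs ! i \<in> carrier_vec n" "(transpose_mat At * At) *\<^sub>v (vs ! i) = (sing_val At (i + 1))\<^sup>2 \<cdot>\<^sub>v (vs ! i)"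
    if "i < k'" for i using vs(2)[OF that] At unfolding eigenvector_def by auto
  define V where "V = mat_of_cols n vs"
  have V: "V \<in> carrier_mat n k'" unfolding V_def using vs(1) by auto
  have colV: "col V i = vs ! i" if "i < k'" for i
    unfolding V_def using vs(1) that v by (subst col_mat_of_cols) auto
  have Pe: "P = V * transpose_mat V"
    unfolding vs(4) using V
    by (intro eq_matI) (auto simp: scalar_prod_def V_def vs(1) mat_of_cols_index lessThan_atLeast0 intro!: sum.cong)
  have VV: "transpose_mat V * V = 1\<^sub>m k'"
    using V vs(3) colV by (intro eq_matI) auto
  show ?thesis
  proof (rule spec_norm_le)
    fix x assume "x \<in> carrier_vec (dim_col (A - A * P))" and x1: "vnorm x \<le> 1"
    then have x: "x \<in> carrier_vec n" using Pe V by simp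
    define z where "z = transpose_mat V *\<^sub>v x"
    define y where "y = x - V *\<^sub>v z"
    have z: "z \<in> carrier_vec k'" unfolding z_def using V x by simp
    have y: "y \<in> carrier_vec n" unfolding y_def using V z x by simp
    have Px: "P *\<^sub>v x = V *\<^sub>v z" unfolding Pe z_def using V x by (simp add: assoc_mult_mat_vec[of _ n k' _ n])
    have "transpose_mat V *\<^sub>v y = transpose_mat V *\<^sub>v x - (transpose_mat V * V) *\<^sub>v z"
      unfolding y_def using V x z by (simp add: mult_minus_distrib_mat_vec[of _ k' n] assoc_mult_mat_vec[of _ k' n _ k'])
    then have Vy: "transpose_mat V *\<^sub>v y = 0\<^sub>v k'" unfolding VV using z z_def by simp
    have orth: "vs ! i \<bullet> y = 0" if "i < k'" for i
    proof -
      have "vs ! i \<bullet> y = (transpose_mat V *\<^sub>v y) $ i" using V that colV by simp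
      then show ?thesis using Vy that by simp
    qed
    have Vzy: "(V *\<^sub>v z) \<bullet> y = 0"
      using transpose_vec_mult_scalar[OF V z y] Vy z V y by (simp add: comm_scalar_prod[of _ n])
    have xe: "x = y + V *\<^sub>v z" unfolding y_def using x V z by (intro eq_vecI) auto
    have Vz: "V *\<^sub>v z \<in> carrier_vec n" using V z by simp
    have "x \<bullet> x = y \<bullet> y + (V *\<^sub>v z) \<bullet> (V *\<^sub>v z)"
      unfolding xe using Vzy comm_scalar_prod[OF y Vz] y Vz
      by (simp add: add_scalar_prod_distrib[OF y Vz] scalar_prod_add_distrib[OF y y Vz] scalar_prod_add_distrib[OF Vz y Vz])
    then have "y \<bullet> y \<le> x \<bullet> x" using scalar_prod_ge_0_real[of "V *\<^sub>v z"] by simp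
    also have "\<dots> \<le> 1" using x1 unfolding vnorm_def by simp
    finally have y1: "y \<bullet> y \<le> 1" .
    have "(A - A * P) *\<^sub>v x = A *\<^sub>v x - A *\<^sub>v (P *\<^sub>v x)"
      using A x V Pe by (simp add: minus_mult_distrib_mat_vec[of _ m n] assoc_mult_mat_vec[of _ m n _ n])
    also have "\<dots> = A *\<^sub>v y" unfolding Px y_def using A x V z by (simp add: mult_minus_distrib_mat_vec[of _ m n])
    finally have e: "(A - A * P) *\<^sub>v x = A *\<^sub>v y" .
    have "(A *\<^sub>v y) \<bullet> (A *\<^sub>v y) \<le> ((sing_val A (k + 1))\<^sup>2 + 2 * \<eta>) * (y \<bullet> y)"
      by (rule top_proj_quadratic_bound[OF A At \<kappa> \<eta> close k'_def v vs(3) y orth])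
    also have "\<dots> \<le> (sing_val A (k + 1))\<^sup>2 + 2 * \<eta>"
      using y1 \<eta> scalar_prod_ge_0_real[of y] by (intro mult_left_le) auto
    also have "\<dots> \<le> (sing_val A (k + 1) + sqrt (2 * \<eta>))\<^sup>2"
      using \<eta> sing_val_nonneg[OF A] by (simp add: power2_sum)
    finally show "vnorm ((A - A * P) *\<^sub>v x) \<le> sing_val A (k + 1) + sqrt (2 * \<eta>)"
      unfolding e vnorm_def using \<eta> sing_val_nonneg[OF A, of "k+1"] by (intro real_le_lsqrt) auto
  qed
qed

section \<open>Moments of sums of random rank-one matrices\<close>

lemma scalar_prod_Cauchy_Schwarz:
  fixes x y :: "real vec"
  assumes x: "x \<in> carrier_vec n" and y: "y \<in> carrier_vec n"
  shows "(x \<bullet> y)\<^sup>2 \<le> (x \<bullet> x) * (y \<bullet> y)"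
proof -
  let ?a = "x \<bullet> x" and ?b = "x \<bullet> y" and ?c = "y \<bullet> y"
  have sq: "0 \<le> s\<^sup>2 * ?a - 2 * s * t * ?b + t\<^sup>2 * ?c" for s t :: real
  proof -
    have "(s \<cdot>\<^sub>v x - t \<cdot>\<^sub>v y) \<bullet> (s \<cdot>\<^sub>v x - t \<cdot>\<^sub>v y) = s\<^sup>2 * ?a - 2 * s * t * ?b + t\<^sup>2 * ?c"
      using assms comm_scalar_prod[OF y x]
      by (simp add: minus_scalar_prod_distrib[of _ n] scalar_prod_minus_distrib[of _ n] power2_eq_square algebra_simps)
    then show ?thesis using scalar_prod_ge_0_real by metis
  qed
  show ?thesis
  proof (cases "?a = 0")
    case True
    then show ?thesis using scalar_prod_self_eq_0_iff[OF x] y by simp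
  next
    case False
    then have "0 < ?a" using scalar_prod_ge_0_real[of x] by simp
    moreover have "0 \<le> ?a * (?a * ?c - ?b\<^sup>2)"
      using sq[of ?b ?a] by (simp add: power2_eq_square algebra_simps)
    ultimately show ?thesis by (simp add: zero_le_mult_iff)
  qed
qed

text \<open>The difference of powers is \<open>a - b\<close> times a sum of terms
  \<open>a ^ (N - i) * b ^ i\<close>, with \<open>N = m - 1\<close> even. Averaging this sum with
  its reversal leaves pairs, each at most \<open>a ^ N + b ^ N\<close>, since
  \<open>\<bar>a\<bar> ^ i - \<bar>b\<bar> ^ i\<close> and
  \<open>\<bar>a\<bar> ^ (N - i) - \<bar>b\<bar> ^ (N - i)\<close> never have opposite
  signs.\<close>

lemma diff_power_mult_diff_le:
  fixes a b :: real
  assumes m: "odd m"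
  shows "(a ^ m - b ^ m) * (a - b) \<le> real m / 2 * (a ^ (m - 1) + b ^ (m - 1)) * (a - b)\<^sup>2"
proof -
  obtain N where N: "m = Suc N" "even N" using m by (cases m) auto
  have reidx: "(\<Sum>i<Suc N. a ^ (N - i) * b ^ i) = (\<Sum>i<Suc N. a ^ i * b ^ (N - i))"
    using sum.nat_diff_reindex[of "\<lambda>i. a ^ i * b ^ (N - i)" "Suc N"] by simp
  have S: "(\<Sum>i<Suc N. a ^ (N - i) * b ^ i) \<le> real m / 2 * (a ^ N + b ^ N)"
  proof -
    have pair: "a ^ (N - i) * b ^ i + a ^ i * b ^ (N - i) \<le> a ^ N + b ^ N" if i: "i \<le> N" for i
    proof -
      have "0 \<le> (\<bar>a\<bar> ^ i - \<bar>b\<bar> ^ i) * (\<bar>a\<bar> ^ (N - i) - \<bar>b\<bar> ^ (N - i))"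
        by (cases "\<bar>a\<bar> \<le> \<bar>b\<bar>") (auto intro: mult_nonpos_nonpos mult_nonneg_nonneg simp: power_mono)
      also have "\<dots> = \<bar>a\<bar> ^ N + \<bar>b\<bar> ^ N - (\<bar>a\<bar> ^ (N - i) * \<bar>b\<bar> ^ i + \<bar>a\<bar> ^ i * \<bar>b\<bar> ^ (N - i))"
        using i by (simp add: algebra_simps flip: power_add)
      finally have "\<bar>a\<bar> ^ (N - i) * \<bar>b\<bar> ^ i + \<bar>a\<bar> ^ i * \<bar>b\<bar> ^ (N - i) \<le> a ^ N + b ^ N"
        using N(2) by (simp add: power_even_abs)
      moreover have "a ^ (N - i) * b ^ i \<le> \<bar>a\<bar> ^ (N - i) * \<bar>b\<bar> ^ i" "a ^ i * b ^ (N - i) \<le> \<bar>a\<bar> ^ i * \<bar>b\<bar> ^ (N - i)"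
        by (metis abs_ge_self abs_mult power_abs)+
      ultimately show ?thesis by linarith
    qed
    have "2 * (\<Sum>i<Suc N. a ^ (N - i) * b ^ i) = (\<Sum>i<Suc N. a ^ (N - i) * b ^ i + a ^ i * b ^ (N - i))"
      using reidx by (simp only: sum.distrib)
    also have "\<dots> \<le> (\<Sum>i<Suc N. a ^ N + b ^ N)" by (intro sum_mono pair) auto
    finally show ?thesis unfolding N(1) by simp
  qed
  have "a ^ m - b ^ m = (a - b) * (\<Sum>i<Suc N. a ^ (N - i) * b ^ i)"
    unfolding N(1) reidx by (rule diff_power_eq_sum)
  then have "(a ^ m - b ^ m) * (a - b) = (\<Sum>i<Suc N. a ^ (N - i) * b ^ i) * (a - b)\<^sup>2"
    by (simp add: power2_eq_square)
  also have "\<dots> \<le> real m / 2 * (a ^ N + b ^ N) * (a - b)\<^sup>2"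
    by (intro mult_right_mono S) auto
  finally show ?thesis using N(1) by simp
qed

text \<open>The sums are traces: the left-hand side is \<open>tr (A - B) (A\<^sup>m - B\<^sup>m)\<close>. Both sides are
  sums over pairs of eigenvectors with weights \<open>(u i \<bullet> v j)\<^sup>2\<close>, so the scalar inequality suffices.\<close>

lemma mean_value_trace_inequality:
  assumes A: "A \<in> carrier_mat n n" "transpose_mat A = A" and B: "B \<in> carrier_mat n n" "transpose_mat B = B"
    and a: "eigensystem n A a u" and b: "eigensystem n B b v" and m: "odd m"
  shows "(\<Sum>i<n. a i ^ m * ((A *\<^sub>v u i) \<bullet> u i - (B *\<^sub>v u i) \<bullet> u i))
      - (\<Sum>j<n. b j ^ m * ((A *\<^sub>v v j) \<bullet> v j - (B *\<^sub>v v j) \<bullet> v j))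
    \<le> real m / 2 * ((\<Sum>i<n. a i ^ (m - 1) * ((A *\<^sub>v u i - B *\<^sub>v u i) \<bullet> (A *\<^sub>v u i - B *\<^sub>v u i)))
      + (\<Sum>j<n. b j ^ (m - 1) * ((A *\<^sub>v v j - B *\<^sub>v v j) \<bullet> (A *\<^sub>v v j - B *\<^sub>v v j))))"
proof -
  define q where "q i j = (u i \<bullet> v j)\<^sup>2" for i j
  note ua = eigensystemD[OF a] and vb = eigensystemD[OF b]
  have cu: "A *\<^sub>v u i \<in> carrier_vec n" "B *\<^sub>v u i \<in> carrier_vec n" if "i < n" for i using A B ua(1)[OF that] by auto
  have cv: "A *\<^sub>v v i \<in> carrier_vec n" "B *\<^sub>v v i \<in> carrier_vec n" if "i < n" for i using A B vb(1)[OF that] by auto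
  \<comment> \<open>\<open>A\<close> acts on its own eigenvector \<open>u i\<close>, while
    \<open>B\<close> is moved by symmetry onto \<open>v j\<close>.\<close>
  have duv: "(A *\<^sub>v u i - B *\<^sub>v u i) \<bullet> v j = (a i - b j) * (u i \<bullet> v j)" if i: "i < n" and j: "j < n" for i j
  proof -
    have "(A *\<^sub>v u i) \<bullet> v j = a i * (u i \<bullet> v j)" using ua(1,2)[OF i] vb(1)[OF j] by simp
    moreover have "(B *\<^sub>v u i) \<bullet> v j = b j * (u i \<bullet> v j)"
      by (rule eigensystem_mult_scalar_prod[OF B b ua(1)[OF i] j])
    ultimately show ?thesis using cu[OF i] vb(1)[OF j]
      by (simp add: minus_scalar_prod_distrib[of _ n] algebra_simps)
  qed
  have dvu: "(A *\<^sub>v v j - B *\<^sub>v v j) \<bullet> u i = (a i - b j) * (u i \<bullet> v j)" if i: "i < n" and j: "j < n" for i j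
  proof -
    have "(B *\<^sub>v v j) \<bullet> u i = b j * (v j \<bullet> u i)" using ua(1)[OF i] vb(1,2)[OF j] by simp
    moreover have "(A *\<^sub>v v j) \<bullet> u i = a i * (v j \<bullet> u i)"
      by (rule eigensystem_mult_scalar_prod[OF A a vb(1)[OF j] i])
    ultimately show ?thesis using cv[OF j] ua(1)[OF i] comm_scalar_prod[OF vb(1)[OF j] ua(1)[OF i]]
      by (simp add: minus_scalar_prod_distrib[of _ n] algebra_simps)
  qed
  have 1: "(A *\<^sub>v u i) \<bullet> u i - (B *\<^sub>v u i) \<bullet> u i = (\<Sum>j<n. (a i - b j) * q i j)" if i: "i < n" for i
  proof -
    have "(A *\<^sub>v u i) \<bullet> u i - (B *\<^sub>v u i) \<bullet> u i = (A *\<^sub>v u i - B *\<^sub>v u i) \<bullet> u i"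
      using cu[OF i] ua(1)[OF i] by (simp add: minus_scalar_prod_distrib[of _ n])
    also have "\<dots> = (\<Sum>j<n. ((A *\<^sub>v u i - B *\<^sub>v u i) \<bullet> v j) * (u i \<bullet> v j))"
      using cu[OF i] ua(1)[OF i] by (intro vb(4)) auto
    finally show ?thesis using duv[OF i] by (simp add: q_def power2_eq_square mult.assoc)
  qed
  have 2: "(A *\<^sub>v v j) \<bullet> v j - (B *\<^sub>v v j) \<bullet> v j = (\<Sum>i<n. (a i - b j) * q i j)" if j: "j < n" for j
  proof -
    have "(A *\<^sub>v v j) \<bullet> v j - (B *\<^sub>v v j) \<bullet> v j = (A *\<^sub>v v j - B *\<^sub>v v j) \<bullet> v j"
      using cv[OF j] vb(1)[OF j] by (simp add: minus_scalar_prod_distrib[of _ n])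
    also have "\<dots> = (\<Sum>i<n. ((A *\<^sub>v v j - B *\<^sub>v v j) \<bullet> u i) * (v j \<bullet> u i))"
      using cv[OF j] vb(1)[OF j] by (intro ua(4)) auto
    also have "\<dots> = (\<Sum>i<n. (a i - b j) * q i j)"
    proof (intro sum.cong refl)
      fix i assume "i \<in> {..<n}"
      then show "((A *\<^sub>v v j - B *\<^sub>v v j) \<bullet> u i) * (v j \<bullet> u i) = (a i - b j) * q i j"
        using dvu[of i j] j comm_scalar_prod[OF vb(1)[OF j] ua(1)[of i]] by (simp add: q_def power2_eq_square)
    qed
    finally show ?thesis .
  qed
  have 3: "(A *\<^sub>v u i - B *\<^sub>v u i) \<bullet> (A *\<^sub>v u i - B *\<^sub>v u i) = (\<Sum>j<n. (a i - b j)\<^sup>2 * q i j)" if i: "i < n" for i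
    using eigensystem_norm[OF b, of "A *\<^sub>v u i - B *\<^sub>v u i"] cu[OF i] duv[OF i] by (simp add: q_def power_mult_distrib)
  have 4: "(A *\<^sub>v v j - B *\<^sub>v v j) \<bullet> (A *\<^sub>v v j - B *\<^sub>v v j) = (\<Sum>i<n. (a i - b j)\<^sup>2 * q i j)" if j: "j < n" for j
    using eigensystem_norm[OF a, of "A *\<^sub>v v j - B *\<^sub>v v j"] cv[OF j] dvu[OF _ j] by (simp add: q_def power_mult_distrib)
  have "(\<Sum>i<n. a i ^ m * ((A *\<^sub>v u i) \<bullet> u i - (B *\<^sub>v u i) \<bullet> u i))
      - (\<Sum>j<n. b j ^ m * ((A *\<^sub>v v j) \<bullet> v j - (B *\<^sub>v v j) \<bullet> v j))
    = (\<Sum>i<n. \<Sum>j<n. a i ^ m * ((a i - b j) * q i j)) - (\<Sum>j<n. \<Sum>i<n. b j ^ m * ((a i - b j) * q i j))"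
    by (simp add: 1 2 sum_distrib_left)
  also have "(\<Sum>j<n. \<Sum>i<n. b j ^ m * ((a i - b j) * q i j)) = (\<Sum>i<n. \<Sum>j<n. b j ^ m * ((a i - b j) * q i j))"
    by (rule sum.swap)
  also have "(\<Sum>i<n. \<Sum>j<n. a i ^ m * ((a i - b j) * q i j)) - \<dots>
    = (\<Sum>i<n. \<Sum>j<n. ((a i ^ m - b j ^ m) * (a i - b j)) * q i j)"
    by (simp add: sum_subtractf algebra_simps)
  also have "\<dots> \<le> (\<Sum>i<n. \<Sum>j<n. (real m / 2 * (a i ^ (m - 1) + b j ^ (m - 1)) * (a i - b j)\<^sup>2) * q i j)"
    by (intro sum_mono mult_right_mono diff_power_mult_diff_le[OF m]) (simp add: q_def)
  also have "\<dots> = real m / 2 * ((\<Sum>i<n. \<Sum>j<n. a i ^ (m - 1) * ((a i - b j)\<^sup>2 * q i j))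
      + (\<Sum>i<n. \<Sum>j<n. b j ^ (m - 1) * ((a i - b j)\<^sup>2 * q i j)))"
    by (simp only: sum_distrib_left sum.distrib[symmetric] distrib_left distrib_right mult.assoc)
  also have "(\<Sum>i<n. \<Sum>j<n. b j ^ (m - 1) * ((a i - b j)\<^sup>2 * q i j))
      = (\<Sum>j<n. \<Sum>i<n. b j ^ (m - 1) * ((a i - b j)\<^sup>2 * q i j))"
    by (rule sum.swap)
  finally show ?thesis by (simp add: 3 4 sum_distrib_left)
qed

lemma rank_one_form:
  fixes v x z :: "real vec"
  assumes "v \<in> carrier_vec n" "x \<in> carrier_vec n" "z \<in> carrier_vec n"
  shows "(\<Sum>a<n. \<Sum>b<n. v $ a * v $ b * (x $ b * z $ a)) = (v \<bullet> x) * (v \<bullet> z)"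
proof -
  have "(v \<bullet> x) * (v \<bullet> z) = (v \<bullet> z) * (v \<bullet> x)" by (rule mult.commute)
  also have "\<dots> = (\<Sum>a<n. \<Sum>b<n. (v $ a * z $ a) * (v $ b * x $ b))"
    using assms by (simp add: scalar_prod_def lessThan_atLeast0 sum_product)
  finally show ?thesis by (simp add: mult_ac)
qed

lemma sum_swap3: "(\<Sum>a\<in>A. \<Sum>b\<in>B. \<Sum>c\<in>C. g a b c) = (\<Sum>c\<in>C. \<Sum>a\<in>A. \<Sum>b\<in>B. g a b c)"
proof -
  have "(\<Sum>a\<in>A. \<Sum>b\<in>B. \<Sum>c\<in>C. g a b c) = (\<Sum>a\<in>A. \<Sum>c\<in>C. \<Sum>b\<in>B. g a b c)"
    by (intro sum.cong refl sum.swap)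
  also have "\<dots> = (\<Sum>c\<in>C. \<Sum>a\<in>A. \<Sum>b\<in>B. g a b c)" by (rule sum.swap)
  finally show ?thesis .
qed

text \<open>In the application \<open>y j\<close> is a normalised row of \<open>A\<close>,
  \<open>w j\<close> its sampling probability and \<open>\<rho> = 1 / r\<close>. Norms at most 1,
  instead of exactly 1, admit zero rows; \<open>frame_bound\<close> says
  \<open>\<Sigma> \<le> \<rho>\<close> for quadratic forms.\<close>

locale weighted_frame =
  fixes d m n :: nat and w :: "nat \<Rightarrow> real" and y :: "nat \<Rightarrow> real vec" and \<rho> :: real
  assumes w_nonneg: "j < m \<Longrightarrow> 0 \<le> w j"
    and w_sum: "(\<Sum>j<m. w j) = 1"
    and y_carrier: "j < m \<Longrightarrow> y j \<in> carrier_vec n"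
    and y_norm: "j < m \<Longrightarrow> y j \<bullet> y j \<le> 1"
    and frame_bound: "x \<in> carrier_vec n \<Longrightarrow> (\<Sum>j<m. w j * (y j \<bullet> x)\<^sup>2) \<le> \<rho> * (x \<bullet> x)"
begin

section \<open>Expectation over independent samples\<close>

definition choices :: "(nat \<Rightarrow> nat) set" where
  "choices = PiE {0..<d} (\<lambda>_. {0..<m})"

text \<open>The sum has the shape of \<open>sample_prob\<close>, so that probabilities are
  expectations of indicators.\<close>

definition expect :: "((nat \<Rightarrow> nat) \<Rightarrow> real) \<Rightarrow> real" where
  "expect f = (\<Sum>J\<in>choices. (\<Prod>s<d. w (J s)) * f J)"

lemma choicesD: "J \<in> choices \<Longrightarrow> s < d \<Longrightarrow> J s < m"
  unfolding choices_def by (auto simp: PiE_iff)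

lemma choices_upd: "J \<in> choices \<Longrightarrow> s < d \<Longrightarrow> i < m \<Longrightarrow> J(s := i) \<in> choices"
  unfolding choices_def by (auto simp: PiE_iff extensional_def)

lemma weight_nonneg: "J \<in> choices \<Longrightarrow> 0 \<le> (\<Prod>s<d. w (J s))"
  by (intro prod_nonneg) (use choicesD w_nonneg in auto)

lemma expect_mono: "(\<And>J. J \<in> choices \<Longrightarrow> f J \<le> g J) \<Longrightarrow> expect f \<le> expect g"
  unfolding expect_def by (intro sum_mono mult_left_mono weight_nonneg) auto

lemma expect_cong: "(\<And>J. J \<in> choices \<Longrightarrow> f J = g J) \<Longrightarrow> expect f = expect g"
  unfolding expect_def by (intro sum.cong) auto

lemma expect_cmult: "expect (\<lambda>J. c * f J) = c * expect f"
  unfolding expect_def sum_distrib_left by (intro sum.cong) auto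

lemma expect_add: "expect (\<lambda>J. f J + g J) = expect f + expect g"
  unfolding expect_def by (simp add: distrib_left sum.distrib)

lemma expect_diff: "expect (\<lambda>J. f J - g J) = expect f - expect g"
  unfolding expect_def by (simp add: right_diff_distrib sum_subtractf)

lemma expect_sum: "expect (\<lambda>J. \<Sum>s\<in>S. f s J) = (\<Sum>s\<in>S. expect (f s))"
  unfolding expect_def sum_distrib_left by (rule sum.swap)

lemma expect_one: "expect (\<lambda>_. 1) = 1"
proof -
  have "expect (\<lambda>_. 1) = (\<Prod>s\<in>{0..<d}. \<Sum>j\<in>{0..<m}. w j)"
    unfolding expect_def choices_def by (subst prod_sum_PiE) (auto simp: lessThan_atLeast0)
  then show ?thesis using w_sum by (simp add: lessThan_atLeast0)
qed

text \<open>The map taking \<open>(J, i)\<close> to \<open>(J(s := i), J s)\<close> is an involution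
  that preserves the weight of \<open>J\<close> times \<open>w i\<close>; hence a sequence and its
  resampled copy are exchangeable.\<close>

lemma expect_exchange:
  assumes s: "s < d"
  shows "expect (\<lambda>J. \<Sum>i<m. w i * F J (J(s := i))) = expect (\<lambda>J. \<Sum>i<m. w i * F (J(s := i)) J)"
proof -
  define W where "W J = (\<Prod>s<d. w (J s))" for J :: "nat \<Rightarrow> nat"
  have Wu: "W (J(s := i)) * w (J s) = W J * w i" for J i
  proof -
    have "W J = w (J s) * (\<Prod>t\<in>{..<d} - {s}. w (J t))" for J
      unfolding W_def using s by (intro prod.remove) auto
    moreover have "(\<Prod>t\<in>{..<d} - {s}. w ((J(s := i)) t)) = (\<Prod>t\<in>{..<d} - {s}. w (J t))"
      by (intro prod.cong) auto
    ultimately show ?thesis by simp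
  qed
  have "expect (\<lambda>J. \<Sum>i<m. w i * F J (J(s := i)))
      = (\<Sum>(J,i)\<in>choices \<times> {..<m}. W J * w i * F J (J(s := i)))"
    unfolding expect_def W_def[symmetric] sum_distrib_left sum.cartesian_product by (simp add: mult.assoc)
  also have "\<dots> = (\<Sum>(J,i)\<in>choices \<times> {..<m}. W J * w i * F (J(s := i)) J)"
  proof (rule sum.reindex_bij_witness[where i = "\<lambda>(J,i). (J(s := i), J s)" and j = "\<lambda>(J,i). (J(s := i), J s)"])
    fix p assume "p \<in> choices \<times> {..<m}"
    then obtain J i where p: "p = (J,i)" "J \<in> choices" "i < m" by auto
    show "(case case p of (J,i) \<Rightarrow> (J(s := i), J s) of (J,i) \<Rightarrow> W J * w i * F (J(s := i)) J)
        = (case p of (J,i) \<Rightarrow> W J * w i * F J (J(s := i)))"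
      using Wu[of J i] p by simp
  qed (use s choices_upd choicesD in auto)
  also have "\<dots> = expect (\<lambda>J. \<Sum>i<m. w i * F (J(s := i)) J)"
    unfolding expect_def W_def[symmetric] sum_distrib_left sum.cartesian_product by (simp add: mult.assoc)
  finally show ?thesis .
qed

section \<open>The centred sum of rank-one samples\<close>

definition mean_form :: "real vec \<Rightarrow> real" where
  "mean_form x = (\<Sum>j<m. w j * (y j \<bullet> x)\<^sup>2)"

text \<open>This is \<open>M\<close> of the overview, and \<open>mean_form\<close> is the quadratic
  form of \<open>\<Sigma>\<close>.\<close>

definition deviation :: "(nat \<Rightarrow> nat) \<Rightarrow> real mat" where
  "deviation J = mat n n (\<lambda>(a,b). (\<Sum>s<d. y (J s) $ a * y (J s) $ b) - real d * (\<Sum>j<m. w j * (y j $ a * y j $ b)))"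

lemma deviation_carrier [simp]: "deviation J \<in> carrier_mat n n"
  unfolding deviation_def by simp

lemma deviation_symmetric: "transpose_mat (deviation J) = deviation J"
  unfolding deviation_def by (intro eq_matI) (auto simp: mult.commute)

lemma deviation_form:
  assumes J: "J \<in> choices" and x: "x \<in> carrier_vec n" and z: "z \<in> carrier_vec n"
  shows "(deviation J *\<^sub>v x) \<bullet> z
    = (\<Sum>s<d. (y (J s) \<bullet> x) * (y (J s) \<bullet> z)) - real d * (\<Sum>j<m. w j * ((y j \<bullet> x) * (y j \<bullet> z)))"
proof -
  have "(deviation J *\<^sub>v x) \<bullet> z = (\<Sum>a<n. \<Sum>b<n.
      ((\<Sum>s<d. y (J s) $ a * y (J s) $ b) - real d * (\<Sum>j<m. w j * (y j $ a * y j $ b))) * (x $ b * z $ a))"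
    using x z by (simp add: deviation_def scalar_prod_def lessThan_atLeast0 sum_distrib_right mult.assoc)
  also have "\<dots> = (\<Sum>a<n. \<Sum>b<n. (\<Sum>s<d. y (J s) $ a * y (J s) $ b * (x $ b * z $ a)))
     - (\<Sum>a<n. \<Sum>b<n. (\<Sum>j<m. real d * (w j * (y j $ a * y j $ b * (x $ b * z $ a)))))"
    by (simp add: left_diff_distrib sum_subtractf sum_distrib_right sum_distrib_left mult.assoc)
  also have "(\<Sum>a<n. \<Sum>b<n. (\<Sum>s<d. y (J s) $ a * y (J s) $ b * (x $ b * z $ a)))
      = (\<Sum>s<d. \<Sum>a<n. \<Sum>b<n. y (J s) $ a * y (J s) $ b * (x $ b * z $ a))"
    by (rule sum_swap3)
  also have "\<dots> = (\<Sum>s<d. (y (J s) \<bullet> x) * (y (J s) \<bullet> z))"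
    by (intro sum.cong refl rank_one_form x z y_carrier choicesD[OF J]) auto
  also have "(\<Sum>a<n. \<Sum>b<n. (\<Sum>j<m. real d * (w j * (y j $ a * y j $ b * (x $ b * z $ a)))))
      = (\<Sum>j<m. real d * (w j * (\<Sum>a<n. \<Sum>b<n. y j $ a * y j $ b * (x $ b * z $ a))))"
    unfolding sum_distrib_left by (rule sum_swap3)
  also have "\<dots> = (\<Sum>j<m. real d * (w j * ((y j \<bullet> x) * (y j \<bullet> z))))"
    using rank_one_form[OF y_carrier x z] by (intro sum.cong refl) auto
  finally show ?thesis by (simp add: sum_distrib_left)
qed

text \<open>Only the summand with index \<open>s\<close> changes, and the mean terms cancel.\<close>

lemma deviation_upd:
  assumes J: "J \<in> choices" and s: "s < d" and i: "i < m" and x: "x \<in> carrier_vec n" and z: "z \<in> carrier_vec n"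
  shows "(deviation J *\<^sub>v x) \<bullet> z - (deviation (J(s := i)) *\<^sub>v x) \<bullet> z
    = (y (J s) \<bullet> x) * (y (J s) \<bullet> z) - (y i \<bullet> x) * (y i \<bullet> z)"
proof -
  have "(\<Sum>t<d. (y (K t) \<bullet> x) * (y (K t) \<bullet> z))
      = (y (K s) \<bullet> x) * (y (K s) \<bullet> z) + (\<Sum>t\<in>{..<d} - {s}. (y (K t) \<bullet> x) * (y (K t) \<bullet> z))" for K
    using s by (intro sum.remove) auto
  moreover have "(\<Sum>t\<in>{..<d} - {s}. (y ((J(s := i)) t) \<bullet> x) * (y ((J(s := i)) t) \<bullet> z))
      = (\<Sum>t\<in>{..<d} - {s}. (y (J t) \<bullet> x) * (y (J t) \<bullet> z))"
    by (intro sum.cong) auto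
  ultimately show ?thesis
    unfolding deviation_form[OF J x z] deviation_form[OF choices_upd[OF J s i] x z] by simp
qed

text \<open>With \<open>p\<close>, \<open>q\<close> the old and the new vector this is \<open>(p
  p\<^sup>T - q q\<^sup>T)\<^sup>2 \<le> 2 (p p\<^sup>T + q q\<^sup>T)\<close>, valid for vectors of
  norm at most 1. It replaces the square in the trace inequality by terms that can be averaged over
  the samples.\<close>

lemma deviation_upd_norm:
  assumes J: "J \<in> choices" and s: "s < d" and i: "i < m" and x: "x \<in> carrier_vec n"
  defines "g \<equiv> deviation J *\<^sub>v x - deviation (J(s := i)) *\<^sub>v x"
  shows "g \<bullet> g \<le> 2 * ((y (J s) \<bullet> x)\<^sup>2 + (y i \<bullet> x)\<^sup>2)"
proof -
  let ?p = "y (J s)" and ?q = "y i"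
  define \<alpha> \<beta> where "\<alpha> = ?p \<bullet> x" and "\<beta> = ?q \<bullet> x"
  have Js: "J s < m" using choicesD[OF J s] .
  have p: "?p \<in> carrier_vec n" and q: "?q \<in> carrier_vec n" using y_carrier Js i by auto
  have cJ: "deviation K *\<^sub>v x \<in> carrier_vec n" for K using deviation_carrier x by (metis mult_mat_vec_carrier)
  have g: "g \<in> carrier_vec n" unfolding g_def using cJ by auto
  have gz: "g \<bullet> z = \<alpha> * (?p \<bullet> z) - \<beta> * (?q \<bullet> z)" if z: "z \<in> carrier_vec n" for z
    unfolding g_def \<alpha>_def \<beta>_def deviation_upd[OF J s i x z, symmetric]
    by (rule minus_scalar_prod_distrib[OF cJ cJ z])
  have pq: "\<bar>?p \<bullet> ?q\<bar> \<le> 1"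
  proof -
    have "(?p \<bullet> ?q)\<^sup>2 \<le> (?p \<bullet> ?p) * (?q \<bullet> ?q)" by (rule scalar_prod_Cauchy_Schwarz[OF p q])
    also have "\<dots> \<le> 1" using y_norm[OF Js] y_norm[OF i] scalar_prod_ge_0_real by (simp add: mult_le_one)
    finally show ?thesis by (simp add: abs_square_le_1)
  qed
  have "g \<bullet> g = \<alpha> * (g \<bullet> ?p) - \<beta> * (g \<bullet> ?q)"
    using gz[OF g] comm_scalar_prod[OF g p] comm_scalar_prod[OF g q] by simp
  also have "\<dots> = \<alpha>\<^sup>2 * (?p \<bullet> ?p) + \<beta>\<^sup>2 * (?q \<bullet> ?q) - 2 * (\<alpha> * \<beta>) * (?p \<bullet> ?q)"
    unfolding gz[OF p] gz[OF q] comm_scalar_prod[OF q p] by (simp add: power2_eq_square algebra_simps)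
  also have "\<dots> \<le> \<alpha>\<^sup>2 + \<beta>\<^sup>2 + (\<alpha>\<^sup>2 + \<beta>\<^sup>2)"
  proof -
    have "- (2 * (\<alpha> * \<beta>) * (?p \<bullet> ?q)) \<le> \<bar>2 * (\<alpha> * \<beta>)\<bar> * \<bar>?p \<bullet> ?q\<bar>" by (metis abs_ge_minus_self abs_mult)
    also have "\<dots> \<le> \<bar>2 * (\<alpha> * \<beta>)\<bar> * 1" by (intro mult_left_mono pq) auto
    also have "\<dots> \<le> \<alpha>\<^sup>2 + \<beta>\<^sup>2" using sum_squares_bound[of "\<bar>\<alpha>\<bar>" "\<bar>\<beta>\<bar>"] by (simp add: abs_mult)
    finally have "- (2 * (\<alpha> * \<beta>) * (?p \<bullet> ?q)) \<le> \<alpha>\<^sup>2 + \<beta>\<^sup>2" .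
    moreover have "\<alpha>\<^sup>2 * (?p \<bullet> ?p) \<le> \<alpha>\<^sup>2" "\<beta>\<^sup>2 * (?q \<bullet> ?q) \<le> \<beta>\<^sup>2"
      using y_norm[OF Js] y_norm[OF i] by (simp_all add: mult_left_le)
    ultimately show ?thesis by linarith
  qed
  finally show ?thesis unfolding \<alpha>_def \<beta>_def by simp
qed

section \<open>Trace moments of the deviation\<close>

definition eigval :: "(nat \<Rightarrow> nat) \<Rightarrow> nat \<Rightarrow> real" where
  "eigval J = (!) (eigvals_desc (deviation J))"

text \<open>One eigenbasis is fixed for each sequence \<open>J\<close>, so that traces of products
  with powers of \<open>M\<close> become sums over its index.\<close>

definition eigvec :: "(nat \<Rightarrow> nat) \<Rightarrow> nat \<Rightarrow> real vec" where
  "eigvec J = (SOME u. eigensystem n (deviation J) (eigval J) u)"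

lemma eigensystem_deviation: "eigensystem n (deviation J) (eigval J) (eigvec J)"
  unfolding eigvec_def
  using someI_ex[OF eigensystem_exists_sorted(1)[OF deviation_carrier deviation_symmetric]]
  unfolding eigval_def .

lemmas deviation_eigenD = eigensystemD[OF eigensystem_deviation]

text \<open>This is \<open>E tr M\<^sup>q\<close>, with the trace written through the
  eigenvalues.\<close>

definition moment :: "nat \<Rightarrow> real" where
  "moment q = expect (\<lambda>J. \<Sum>b<n. eigval J b ^ q)"

lemma eigval_eq_form:
  assumes J: "J \<in> choices" and b: "b < n"
  shows "eigval J b = (\<Sum>s<d. (y (J s) \<bullet> eigvec J b)\<^sup>2) - real d * mean_form (eigvec J b)"
proof -
  have "eigval J b = (deviation J *\<^sub>v eigvec J b) \<bullet> eigvec J b"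
    using deviation_eigenD(1,2)[where J = J, OF b] deviation_eigenD(3)[where J = J, OF b b] by simp
  then show ?thesis
    unfolding deviation_form[OF J deviation_eigenD(1)[OF b] deviation_eigenD(1)[OF b]] mean_form_def by (simp add: power2_eq_square)
qed

text \<open>Resampling the coordinate \<open>s\<close> gives an exchangeable pair, and the summand with index \<open>s\<close>
  is centred conditionally on the resampled sequence; so its pairing with the power of the
  deviation may be replaced by half of a difference of powers.\<close>

lemma moment_coordinate_bound:
  assumes s: "s < d" and q: "odd q"
  shows "expect (\<lambda>J. \<Sum>b<n. eigval J b ^ q * ((y (J s) \<bullet> eigvec J b)\<^sup>2 - mean_form (eigvec J b)))
    \<le> real q * expect (\<lambda>J. \<Sum>b<n. eigval J b ^ (q - 1) * ((y (J s) \<bullet> eigvec J b)\<^sup>2 + mean_form (eigvec J b)))"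
proof -
  \<comment> \<open>With \<open>X\<close> the centred summand of \<open>J\<close> at
    \<open>s\<close> and \<open>M\<close> the deviation of \<open>K\<close>, this is
    \<open>tr X M\<^sup>q\<close>; \<open>h\<close> is the analogous trace of two added rank-one
    terms against \<open>M\<^sup>q\<^sup>-\<^sup>1\<close>.\<close>
  define f where "f J K = (\<Sum>b<n. eigval K b ^ q * ((y (J s) \<bullet> eigvec K b)\<^sup>2 - mean_form (eigvec K b)))" for J K
  define h where "h J J' K = (\<Sum>b<n. eigval K b ^ (q - 1) * ((y (J s) \<bullet> eigvec K b)\<^sup>2 + (y (J' s) \<bullet> eigvec K b)\<^sup>2))" for J J' K
  have resample: "(\<Sum>i<m. w i * c) = c" for c
    using w_sum by (simp flip: sum_distrib_right)
  \<comment> \<open>After the exchange the sample at \<open>s\<close> is averaged while the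
    deviation stays fixed, and the centred summand averages to zero.\<close>
  have zero: "expect (\<lambda>J. \<Sum>i<m. w i * f J (J(s := i))) = 0"
  proof -
    have "(\<Sum>i<m. w i * f (J(s := i)) J) = 0" for J
    proof -
      have "(\<Sum>i<m. w i * f (J(s := i)) J)
          = (\<Sum>b<n. \<Sum>i<m. w i * (eigval J b ^ q * ((y i \<bullet> eigvec J b)\<^sup>2 - mean_form (eigvec J b))))"
        unfolding f_def sum_distrib_left by (subst sum.swap) simp
      also have "\<dots> = (\<Sum>b<n. eigval J b ^ q * ((\<Sum>i<m. w i * (y i \<bullet> eigvec J b)\<^sup>2) - (\<Sum>i<m. w i * mean_form (eigvec J b))))"
        by (intro sum.cong refl) (simp add: sum_distrib_left sum_subtractf[symmetric] algebra_simps)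
      also have "\<dots> = 0" unfolding resample by (simp add: mean_form_def)
      finally show ?thesis .
    qed
    then show ?thesis unfolding expect_exchange[OF s] by (simp add: expect_def)
  qed
  \<comment> \<open>If \<open>J'\<close> differs from \<open>J\<close> only at \<open>s\<close>,
    this is \<open>tr (M - M') (M\<^sup>q - M'\<^sup>q)\<close> for the two deviations. In
    expectation the mixed terms vanish and the diagonal ones agree, hence the factor 2
    below.\<close>
  define D where "D J J' = (f J J - f J' J) - (f J J' - f J' J')" for J J'
  have "2 * expect (\<lambda>J. f J J) = expect (\<lambda>J. \<Sum>i<m. w i * D J (J(s := i)))"
  proof -
    have "expect (\<lambda>J. \<Sum>i<m. w i * D J (J(s := i))) =
        expect (\<lambda>J. \<Sum>i<m. w i * f J J) - expect (\<lambda>J. \<Sum>i<m. w i * f (J(s := i)) J)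
        - (expect (\<lambda>J. \<Sum>i<m. w i * f J (J(s := i))) - expect (\<lambda>J. \<Sum>i<m. w i * f (J(s := i)) (J(s := i))))"
      unfolding expect_diff[symmetric] D_def by (simp add: right_diff_distrib sum_subtractf)
    also have "expect (\<lambda>J. \<Sum>i<m. w i * f (J(s := i)) (J(s := i))) = expect (\<lambda>J. \<Sum>i<m. w i * f J J)"
      using expect_exchange[OF s, of "\<lambda>J K. f K K"] by simp
    also have "expect (\<lambda>J. \<Sum>i<m. w i * f (J(s := i)) J) = expect (\<lambda>J. \<Sum>i<m. w i * f J (J(s := i)))"
      by (rule expect_exchange[OF s, symmetric])
    finally show ?thesis unfolding zero resample by linarith
  qed
  also have "\<dots> \<le> expect (\<lambda>J. \<Sum>i<m. w i * (real q * (h J (J(s := i)) J + h J (J(s := i)) (J(s := i)))))"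
  proof (intro expect_mono sum_mono mult_left_mono)
    fix J i assume J: "J \<in> choices" and "i \<in> {..<m}"
    then have i: "i < m" and J': "J(s := i) \<in> choices" using choices_upd[OF J s] by auto
    let ?J = "J(s := i)"
    have df: "f J K - f ?J K = (\<Sum>b<n. eigval K b ^ q *
        ((deviation J *\<^sub>v eigvec K b) \<bullet> eigvec K b - (deviation ?J *\<^sub>v eigvec K b) \<bullet> eigvec K b))" for K
      unfolding f_def sum_subtractf[symmetric]
    proof (intro sum.cong refl)
      fix b assume "b \<in> {..<n}"
      then have "b < n" by simp
      show "eigval K b ^ q * ((y (J s) \<bullet> eigvec K b)\<^sup>2 - mean_form (eigvec K b))
          - eigval K b ^ q * ((y (?J s) \<bullet> eigvec K b)\<^sup>2 - mean_form (eigvec K b))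
        = eigval K b ^ q * ((deviation J *\<^sub>v eigvec K b) \<bullet> eigvec K b - (deviation ?J *\<^sub>v eigvec K b) \<bullet> eigvec K b)"
        unfolding deviation_upd[OF J s i deviation_eigenD(1)[OF \<open>b < n\<close>] deviation_eigenD(1)[OF \<open>b < n\<close>]]
        by (simp add: power2_eq_square algebra_simps)
    qed
    have "D J ?J \<le> real q / 2 *
       ((\<Sum>b<n. eigval J b ^ (q - 1) * ((deviation J *\<^sub>v eigvec J b - deviation ?J *\<^sub>v eigvec J b)
            \<bullet> (deviation J *\<^sub>v eigvec J b - deviation ?J *\<^sub>v eigvec J b)))
      + (\<Sum>b<n. eigval ?J b ^ (q - 1) * ((deviation J *\<^sub>v eigvec ?J b - deviation ?J *\<^sub>v eigvec ?J b)
            \<bullet> (deviation J *\<^sub>v eigvec ?J b - deviation ?J *\<^sub>v eigvec ?J b))))"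
      unfolding D_def df
      by (rule mean_value_trace_inequality[OF deviation_carrier deviation_symmetric deviation_carrier
            deviation_symmetric eigensystem_deviation eigensystem_deviation q])
    also have "\<dots> \<le> real q / 2 *
       ((\<Sum>b<n. eigval J b ^ (q - 1) * (2 * ((y (J s) \<bullet> eigvec J b)\<^sup>2 + (y i \<bullet> eigvec J b)\<^sup>2)))
      + (\<Sum>b<n. eigval ?J b ^ (q - 1) * (2 * ((y (J s) \<bullet> eigvec ?J b)\<^sup>2 + (y i \<bullet> eigvec ?J b)\<^sup>2))))"
      using q by (intro mult_left_mono add_mono sum_mono deviation_upd_norm[OF J s i] deviation_eigenD(1)) (auto simp: zero_le_even_power)
    also have "\<dots> = real q * (h J ?J J + h J ?J ?J)"
    proof -
      have pull: "(\<Sum>b<n. g b * (2 * k b)) = 2 * (\<Sum>b<n. g b * k b)" for g k :: "nat \<Rightarrow> real"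
        unfolding sum_distrib_left by (intro sum.cong refl) simp
      show ?thesis unfolding h_def pull by simp
    qed
    finally show "D J ?J \<le> real q * (h J ?J J + h J ?J ?J)" .
  qed (use w_nonneg in auto)
  also have "\<dots> = real q * (expect (\<lambda>J. \<Sum>i<m. w i * h J (J(s := i)) J) + expect (\<lambda>J. \<Sum>i<m. w i * h J (J(s := i)) (J(s := i))))"
    unfolding expect_add[symmetric] expect_cmult[symmetric]
    by (intro expect_cong) (simp add: sum_distrib_left sum.distrib algebra_simps)
  also have "expect (\<lambda>J. \<Sum>i<m. w i * h J (J(s := i)) (J(s := i))) = expect (\<lambda>J. \<Sum>i<m. w i * h J (J(s := i)) J)"
  proof -
    have "expect (\<lambda>J. \<Sum>i<m. w i * h J (J(s := i)) (J(s := i))) = expect (\<lambda>J. \<Sum>i<m. w i * h (J(s := i)) J J)"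
      by (rule expect_exchange[OF s, of "\<lambda>J K. h J K K"])
    moreover have "h (J(s := i)) J J = h J (J(s := i)) J" for J i
      unfolding h_def by (simp add: add.commute)
    ultimately show ?thesis by simp
  qed
  also have "expect (\<lambda>J. \<Sum>i<m. w i * h J (J(s := i)) J)
      = expect (\<lambda>J. \<Sum>b<n. eigval J b ^ (q - 1) * ((y (J s) \<bullet> eigvec J b)\<^sup>2 + mean_form (eigvec J b)))"
  proof (rule expect_cong)
    fix J
    have "(\<Sum>i<m. w i * h J (J(s := i)) J)
        = (\<Sum>b<n. \<Sum>i<m. w i * (eigval J b ^ (q - 1) * ((y (J s) \<bullet> eigvec J b)\<^sup>2 + (y i \<bullet> eigvec J b)\<^sup>2)))"
      unfolding h_def sum_distrib_left by (subst sum.swap) simp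
    also have "\<dots> = (\<Sum>b<n. eigval J b ^ (q - 1) * ((\<Sum>i<m. w i * (y (J s) \<bullet> eigvec J b)\<^sup>2) + (\<Sum>i<m. w i * (y i \<bullet> eigvec J b)\<^sup>2)))"
    proof -
      have "(\<Sum>i<m. w i * (c * (e + k i))) = c * ((\<Sum>i<m. w i * e) + (\<Sum>i<m. w i * k i))" for c e k
        by (simp add: sum_distrib_left sum.distrib distrib_left mult.left_commute)
      then show ?thesis by simp
    qed
    finally show "(\<Sum>i<m. w i * h J (J(s := i)) J)
      = (\<Sum>b<n. eigval J b ^ (q - 1) * ((y (J s) \<bullet> eigvec J b)\<^sup>2 + mean_form (eigvec J b)))"
      unfolding resample mean_form_def .
  qed
  finally show ?thesis unfolding f_def by simp
qed

text \<open>\<open>eigval_eq_form\<close> expands one of the \<open>q + 1\<close> eigenvalue factors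
  into a sum over \<open>s\<close>. Once each coordinate is bounded, the terms
  \<open>y y\<^sup>T + \<Sigma>\<close> add up over \<open>s\<close> to
  \<open>M + 2 d \<Sigma>\<close>.\<close>

lemma moment_step:
  assumes q: "odd q"
  shows "moment (Suc q) \<le> real q * expect (\<lambda>J. \<Sum>b<n. eigval J b ^ (q - 1) * (eigval J b + 2 * (real d * mean_form (eigvec J b))))"
proof -
  have "moment (Suc q) = expect (\<lambda>J. \<Sum>s<d. \<Sum>b<n. eigval J b ^ q * ((y (J s) \<bullet> eigvec J b)\<^sup>2 - mean_form (eigvec J b)))"
    unfolding moment_def
  proof (rule expect_cong)
    fix J assume J: "J \<in> choices"
    have "eigval J b ^ Suc q = (\<Sum>s<d. eigval J b ^ q * ((y (J s) \<bullet> eigvec J b)\<^sup>2 - mean_form (eigvec J b)))"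
      if b: "b < n" for b
      using arg_cong[OF eigval_eq_form[OF J b], of "\<lambda>t. eigval J b ^ q * t"]
      by (simp add: sum_distrib_left[symmetric] sum_subtractf mult.commute)
    then show "(\<Sum>b<n. eigval J b ^ Suc q) = (\<Sum>s<d. \<Sum>b<n. eigval J b ^ q * ((y (J s) \<bullet> eigvec J b)\<^sup>2 - mean_form (eigvec J b)))"
      by (subst sum.swap) simp
  qed
  also have "\<dots> = (\<Sum>s<d. expect (\<lambda>J. \<Sum>b<n. eigval J b ^ q * ((y (J s) \<bullet> eigvec J b)\<^sup>2 - mean_form (eigvec J b))))"
    by (rule expect_sum)
  also have "\<dots> \<le> (\<Sum>s<d. real q * expect (\<lambda>J. \<Sum>b<n. eigval J b ^ (q - 1) * ((y (J s) \<bullet> eigvec J b)\<^sup>2 + mean_form (eigvec J b))))"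
    by (intro sum_mono moment_coordinate_bound q) auto
  also have "\<dots> = real q * expect (\<lambda>J. \<Sum>s<d. \<Sum>b<n. eigval J b ^ (q - 1) * ((y (J s) \<bullet> eigvec J b)\<^sup>2 + mean_form (eigvec J b)))"
    unfolding expect_sum by (simp add: sum_distrib_left)
  also have "expect (\<lambda>J. \<Sum>s<d. \<Sum>b<n. eigval J b ^ (q - 1) * ((y (J s) \<bullet> eigvec J b)\<^sup>2 + mean_form (eigvec J b)))
     = expect (\<lambda>J. \<Sum>b<n. eigval J b ^ (q - 1) * (eigval J b + 2 * (real d * mean_form (eigvec J b))))"
  proof (rule expect_cong)
    fix J assume J: "J \<in> choices"
    have "(\<Sum>s<d. eigval J b ^ (q - 1) * ((y (J s) \<bullet> eigvec J b)\<^sup>2 + mean_form (eigvec J b)))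
        = eigval J b ^ (q - 1) * (eigval J b + 2 * (real d * mean_form (eigvec J b)))" if b: "b < n" for b
    proof -
      have "(\<Sum>s<d. (y (J s) \<bullet> eigvec J b)\<^sup>2 + mean_form (eigvec J b)) = eigval J b + 2 * (real d * mean_form (eigvec J b))"
        using eigval_eq_form[OF J b] by (simp add: sum.distrib)
      then show ?thesis by (simp add: sum_distrib_left[symmetric])
    qed
    then show "(\<Sum>s<d. \<Sum>b<n. eigval J b ^ (q - 1) * ((y (J s) \<bullet> eigvec J b)\<^sup>2 + mean_form (eigvec J b)))
      = (\<Sum>b<n. eigval J b ^ (q - 1) * (eigval J b + 2 * (real d * mean_form (eigvec J b))))"
      by (subst sum.swap) simp
  qed
  finally show ?thesis .
qed

text \<open>For \<open>q = 1\<close> the power in \<open>moment_step\<close> is 1, and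
  \<open>tr (M + 2 d \<Sigma>) \<le> 2 d\<close> because every \<open>y y\<^sup>T\<close> has trace
  at most 1. This start of the recursion keeps the dimension out of the bound.\<close>

lemma moment_2: "moment 2 \<le> 2 * real d"
proof -
  have tr: "(\<Sum>b<n. (y j \<bullet> eigvec J b)\<^sup>2) \<le> 1" if "j < m" for j J
    using eigensystem_norm[OF eigensystem_deviation y_carrier[OF that]] y_norm[OF that] by metis
  have trm: "(\<Sum>b<n. mean_form (eigvec J b)) \<le> 1" for J
  proof -
    have "(\<Sum>b<n. mean_form (eigvec J b)) = (\<Sum>j<m. w j * (\<Sum>b<n. (y j \<bullet> eigvec J b)\<^sup>2))"
      unfolding mean_form_def sum_distrib_left by (rule sum.swap)
    also have "\<dots> \<le> (\<Sum>j<m. w j * 1)" by (intro sum_mono mult_left_mono tr w_nonneg) auto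
    finally show ?thesis using w_sum by simp
  qed
  have "moment (Suc 1) \<le> real 1 * expect (\<lambda>J. \<Sum>b<n. eigval J b ^ (1 - 1) * (eigval J b + 2 * (real d * mean_form (eigvec J b))))"
    by (rule moment_step) simp
  also have "\<dots> \<le> expect (\<lambda>J. 2 * real d * 1)"
  proof -
    have "(\<Sum>b<n. eigval J b + 2 * (real d * mean_form (eigvec J b))) \<le> 2 * real d" if J: "J \<in> choices" for J
    proof -
      have "(\<Sum>b<n. eigval J b + 2 * (real d * mean_form (eigvec J b)))
          = (\<Sum>b<n. (\<Sum>s<d. (y (J s) \<bullet> eigvec J b)\<^sup>2) + real d * mean_form (eigvec J b))"
        using eigval_eq_form[OF J] by (intro sum.cong refl) simp
      also have "\<dots> = (\<Sum>s<d. \<Sum>b<n. (y (J s) \<bullet> eigvec J b)\<^sup>2) + real d * (\<Sum>b<n. mean_form (eigvec J b))"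
        unfolding sum.distrib sum_distrib_left by (subst sum.swap) simp
      also have "\<dots> \<le> (\<Sum>s<d. 1) + real d * 1"
        by (intro add_mono sum_mono mult_left_mono trm tr choicesD[OF J]) auto
      finally show ?thesis by simp
    qed
    then show ?thesis unfolding of_nat_1 mult_1 by (intro expect_mono) simp
  qed
  finally show ?thesis unfolding expect_cmult expect_one by (simp add: numeral_2_eq_2)
qed

text \<open>The term \<open>q * t ^ q\<close> is split by AM-GM into \<open>t ^ (q + 1) / 2\<close>, which is absorbed on the left,
  and \<open>q\<^sup>2 * t ^ (q - 1) / 2\<close>.\<close>

lemma moment_recursion:
  assumes q: "odd q"
  shows "moment (Suc q) \<le> ((real q)\<^sup>2 + 4 * real d * \<rho> * real q) * moment (q - 1)"
proof -
  have "moment (Suc q) \<le> real q * expect (\<lambda>J. \<Sum>b<n. eigval J b ^ (q - 1) * (eigval J b + 2 * (real d * mean_form (eigvec J b))))"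
    by (rule moment_step[OF q])
  also have "\<dots> = expect (\<lambda>J. \<Sum>b<n. eigval J b ^ (q - 1) * (real q * eigval J b + 2 * (real q * real d * mean_form (eigvec J b))))"
    unfolding expect_cmult[symmetric] sum_distrib_left by (intro expect_cong sum.cong refl) (simp add: algebra_simps)
  also have "\<dots> \<le> expect (\<lambda>J. \<Sum>b<n. 1 / 2 * eigval J b ^ Suc q + ((real q)\<^sup>2 / 2 + 2 * real d * \<rho> * real q) * eigval J b ^ (q - 1))"
  proof (intro expect_mono sum_mono)
    fix J b assume "b \<in> {..<n}"
    then have b: "b < n" by simp
    let ?t = "eigval J b"
    have pw: "?t ^ Suc q = ?t ^ (q - 1) * ?t\<^sup>2" using q by (cases q) (auto simp: power2_eq_square)
    have "mean_form (eigvec J b) \<le> \<rho> * (eigvec J b \<bullet> eigvec J b)"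
      unfolding mean_form_def by (rule frame_bound[OF deviation_eigenD(1)[OF b]])
    then have mf: "mean_form (eigvec J b) \<le> \<rho>" using deviation_eigenD(3)[OF b b] by simp
    have "0 \<le> (?t - real q)\<^sup>2" by simp
    then have "real q * ?t \<le> ?t\<^sup>2 / 2 + (real q)\<^sup>2 / 2" by (simp add: power2_diff algebra_simps)
    moreover have "real q * real d * mean_form (eigvec J b) \<le> real q * real d * \<rho>"
      by (intro mult_left_mono mf) auto
    ultimately have "?t ^ (q - 1) * (real q * ?t + 2 * (real q * real d * mean_form (eigvec J b)))
        \<le> ?t ^ (q - 1) * (?t\<^sup>2 / 2 + (real q)\<^sup>2 / 2 + 2 * (real q * real d * \<rho>))"
      using q by (intro mult_left_mono) (auto simp: zero_le_even_power)
    also have "?t ^ (q - 1) * (?t\<^sup>2 / 2 + (real q)\<^sup>2 / 2 + 2 * (real q * real d * \<rho>))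
        = 1 / 2 * ?t ^ Suc q + ((real q)\<^sup>2 / 2 + 2 * real d * \<rho> * real q) * ?t ^ (q - 1)"
      unfolding pw by (simp add: algebra_simps)
    finally show "?t ^ (q - 1) * (real q * ?t + 2 * (real q * real d * mean_form (eigvec J b)))
        \<le> 1 / 2 * ?t ^ Suc q + ((real q)\<^sup>2 / 2 + 2 * real d * \<rho> * real q) * ?t ^ (q - 1)" .
  qed
  also have "\<dots> = 1 / 2 * moment (Suc q) + ((real q)\<^sup>2 / 2 + 2 * real d * \<rho> * real q) * moment (q - 1)"
    unfolding moment_def expect_cmult[symmetric] expect_add[symmetric] by (simp add: sum.distrib sum_distrib_left)
  finally show ?thesis by (simp add: algebra_simps)
qed

lemma moment_nonneg: "even q \<Longrightarrow> 0 \<le> moment q"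
  using expect_mono[of "\<lambda>_. 0" "\<lambda>J. \<Sum>b<n. eigval J b ^ q"]
  unfolding moment_def by (simp add: expect_def sum_nonneg zero_le_even_power)

text \<open>The recursion is iterated \<open>p - 1\<close> times from \<open>moment_2\<close>. Each
  factor \<open>q (q + 4 d \<rho>)\<close> is at most \<open>2 p (5 d \<rho>)\<close>, since
  \<open>q \<le> 2 p \<le> d \<rho>\<close>.\<close>

lemma moment_bound:
  assumes \<rho>: "0 \<le> \<rho>" and p: "1 \<le> p" "2 * real p \<le> real d * \<rho>"
  shows "moment (2 * p) \<le> 2 * real d * (10 * real p * real d * \<rho>) ^ (p - 1)"
proof -
  let ?c = "10 * real p * real d * \<rho>"
  have "moment (2 * Suc k) \<le> 2 * real d * ?c ^ k" if "Suc k \<le> p" for k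
    using that
  proof (induction k)
    case 0
    then show ?case using moment_2 by simp
  next
    case (Suc k)
    let ?q = "2 * Suc k + 1"
    have "real ?q \<le> 2 * real p" using Suc.prems by simp
    then have q: "real ?q \<le> 2 * real p" "real ?q \<le> real d * \<rho>" using p(2) by simp_all
    have "moment (2 * Suc (Suc k)) = moment (Suc ?q)" by simp
    also have "\<dots> \<le> ((real ?q)\<^sup>2 + 4 * real d * \<rho> * real ?q) * moment (?q - 1)"
      by (rule moment_recursion) simp
    also have "\<dots> \<le> ?c * moment (?q - 1)"
    proof (rule mult_right_mono)
      have "(real ?q)\<^sup>2 + 4 * real d * \<rho> * real ?q = real ?q * (real ?q + 4 * real d * \<rho>)"
        by (simp add: power2_eq_square algebra_simps)
      also have "\<dots> \<le> 2 * real p * (5 * (real d * \<rho>))"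
        using q \<rho> by (intro mult_mono) (auto simp: algebra_simps)
      finally show "(real ?q)\<^sup>2 + 4 * real d * \<rho> * real ?q \<le> ?c" by (simp add: algebra_simps)
    qed (simp add: moment_nonneg)
    also have "\<dots> \<le> ?c * (2 * real d * ?c ^ k)"
      using Suc \<rho> by (intro mult_left_mono) auto
    finally show ?case by (simp add: algebra_simps)
  qed
  from this[of "p - 1"] show ?thesis using p(1) by simp
qed

text \<open>Markov's inequality: if the quadratic form exceeds the bound somewhere, some eigenvalue
  exceeds \<open>t\<close> in modulus, and its even power alone makes
  \<open>tr M\<^sup>2\<^sup>p\<close> at least \<open>t\<^sup>2\<^sup>p\<close>.\<close>

lemma deviation_tail:
  assumes t: "0 < t" and \<rho>: "0 \<le> \<rho>" and p: "1 \<le> p" "2 * real p \<le> real d * \<rho>"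
  shows "1 - 2 * real d * (10 * real p * real d * \<rho>) ^ (p - 1) / t ^ (2 * p)
    \<le> expect (\<lambda>J. if \<forall>x\<in>carrier_vec n. \<bar>(deviation J *\<^sub>v x) \<bullet> x\<bar> \<le> t * (x \<bullet> x) then 1 else 0)"
proof -
  let ?good = "\<lambda>J. \<forall>x\<in>carrier_vec n. \<bar>(deviation J *\<^sub>v x) \<bullet> x\<bar> \<le> t * (x \<bullet> x)"
  have "1 - (\<Sum>b<n. eigval J b ^ (2 * p)) / t ^ (2 * p) \<le> (if ?good J then 1 else 0)" if "J \<in> choices" for J
  proof (cases "?good J")
    case True
    have "0 \<le> (\<Sum>b<n. eigval J b ^ (2 * p)) / t ^ (2 * p)"
      using t by (intro divide_nonneg_nonneg sum_nonneg) (auto simp: zero_le_even_power)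
    then show ?thesis using True by simp
  next
    case False
    have "\<exists>b<n. t < \<bar>eigval J b\<bar>"
    proof (rule ccontr)
      assume "\<not> (\<exists>b<n. t < \<bar>eigval J b\<bar>)"
      then have le: "\<bar>eigval J b\<bar> \<le> t" if "b < n" for b using that by force
      have "?good J"
      proof
        fix x :: "real vec" assume x: "x \<in> carrier_vec n"
        have "\<bar>(deviation J *\<^sub>v x) \<bullet> x\<bar> = \<bar>\<Sum>b<n. eigval J b * (x \<bullet> eigvec J b)\<^sup>2\<bar>"
          by (simp only: eigensystem_quadratic_form[OF deviation_carrier deviation_symmetric eigensystem_deviation x])
        also have "\<dots> \<le> (\<Sum>b<n. \<bar>eigval J b * (x \<bullet> eigvec J b)\<^sup>2\<bar>)" by (rule sum_abs)
        also have "\<dots> \<le> (\<Sum>b<n. t * (x \<bullet> eigvec J b)\<^sup>2)"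
          by (intro sum_mono) (auto simp: abs_mult intro!: mult_right_mono le)
        also have "\<dots> = t * (x \<bullet> x)"
          unfolding eigensystem_norm[OF eigensystem_deviation[of J] x] by (simp add: sum_distrib_left)
        finally show "\<bar>(deviation J *\<^sub>v x) \<bullet> x\<bar> \<le> t * (x \<bullet> x)" .
      qed
      with False show False by simp
    qed
    then obtain b where b: "b < n" "t < \<bar>eigval J b\<bar>" by auto
    have "t ^ (2 * p) \<le> \<bar>eigval J b\<bar> ^ (2 * p)" using b t by (intro power_mono) auto
    also have "\<dots> = eigval J b ^ (2 * p)" by (simp add: power_even_abs)
    also have "\<dots> \<le> (\<Sum>b<n. eigval J b ^ (2 * p))"
      using b(1) by (intro member_le_sum) (auto simp: zero_le_even_power)
    finally show ?thesis unfolding if_not_P[OF False] using t by (simp add: field_simps)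
  qed
  then have "expect (\<lambda>J. 1 - (\<Sum>b<n. eigval J b ^ (2 * p)) / t ^ (2 * p)) \<le> expect (\<lambda>J. if ?good J then 1 else 0)"
    by (rule expect_mono)
  moreover have "expect (\<lambda>J. 1 - (\<Sum>b<n. eigval J b ^ (2 * p)) / t ^ (2 * p)) = 1 - moment (2 * p) / t ^ (2 * p)"
    unfolding moment_def expect_diff expect_one
    using expect_cmult[of "1 / t ^ (2 * p)" "\<lambda>J. \<Sum>b<n. eigval J b ^ (2 * p)"] by simp
  moreover have "moment (2 * p) / t ^ (2 * p) \<le> 2 * real d * (10 * real p * real d * \<rho>) ^ (p - 1) / t ^ (2 * p)"
    using moment_bound[OF \<rho> p] t by (intro divide_right_mono) auto
  ultimately show ?thesis by linarith
qed

end

section \<open>Spectral and Frobenius norm\<close>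

lemma scalar_prod_mult_mat_vec:
  fixes A :: "real mat"
  assumes "A \<in> carrier_mat m n"
  shows "(A *\<^sub>v x) \<bullet> (A *\<^sub>v x) = (\<Sum>j<m. (row A j \<bullet> x)\<^sup>2)"
  using assms by (simp add: scalar_prod_def[of "A *\<^sub>v x"] lessThan_atLeast0 power2_eq_square)

lemma fro_norm_sq_rows:
  assumes "A \<in> carrier_mat m n"
  shows "(fro_norm A)\<^sup>2 = (\<Sum>j<m. (vnorm (row A j))\<^sup>2)"
proof -
  have "(fro_norm A)\<^sup>2 = (\<Sum>i<m. \<Sum>j<n. (A $$ (i, j))\<^sup>2)"
    unfolding fro_norm_def using assms by (simp add: sum_nonneg)
  also have "\<dots> = (\<Sum>j<m. (vnorm (row A j))\<^sup>2)"
    unfolding vnorm_sq using assms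
    by (intro sum.cong refl) (simp add: scalar_prod_def lessThan_atLeast0 power2_eq_square)
  finally show ?thesis .
qed

lemma mult_mat_vec_fro_norm_bound:
  assumes A: "A \<in> carrier_mat m n" and x: "x \<in> carrier_vec n"
  shows "(A *\<^sub>v x) \<bullet> (A *\<^sub>v x) \<le> (fro_norm A)\<^sup>2 * (x \<bullet> x)"
  unfolding scalar_prod_mult_mat_vec[OF A] fro_norm_sq_rows[OF A] sum_distrib_right vnorm_sq
  using A by (intro sum_mono scalar_prod_Cauchy_Schwarz[OF _ x]) (auto intro: row_carrier_vec)

lemma fro_norm_nonneg: "0 \<le> fro_norm A"
  unfolding fro_norm_def by (simp add: sum_nonneg)

text \<open>This bounds the set in \<open>spec_norm\<close>, which makes its supremum an upper
  bound, and through \<open>spec_norm_le_fro_norm\<close> it yields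
  \<open>r \<ge> 1\<close>.\<close>

lemma vnorm_le_fro_norm:
  assumes A: "A \<in> carrier_mat m n" and x: "x \<in> carrier_vec n" "vnorm x \<le> 1"
  shows "vnorm (A *\<^sub>v x) \<le> fro_norm A"
proof -
  have "(A *\<^sub>v x) \<bullet> (A *\<^sub>v x) \<le> (fro_norm A)\<^sup>2 * (x \<bullet> x)" by (rule mult_mat_vec_fro_norm_bound[OF A x(1)])
  also have "\<dots> \<le> (fro_norm A)\<^sup>2" using x(2) unfolding vnorm_def by (intro mult_left_le) auto
  finally show ?thesis unfolding vnorm_def using fro_norm_nonneg by (intro real_le_lsqrt) auto
qed

lemma spec_norm_le_fro_norm:
  assumes "A \<in> carrier_mat m n"
  shows "spec_norm A \<le> fro_norm A"
  using assms vnorm_le_fro_norm by (intro spec_norm_le) auto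

lemma vnorm_mult_le_spec_norm:
  assumes A: "A \<in> carrier_mat m n" and x: "x \<in> carrier_vec n" "vnorm x \<le> 1"
  shows "vnorm (A *\<^sub>v x) \<le> spec_norm A"
  unfolding spec_norm_def
proof (rule cSup_upper)
  show "bdd_above {vnorm (A *\<^sub>v x) |x. x \<in> carrier_vec (dim_col A) \<and> vnorm x \<le> 1}"
    using vnorm_le_fro_norm[OF A] A by (intro bdd_aboveI[of _ "fro_norm A"]) auto
qed (use assms in auto)

lemma spec_norm_nonneg:
  assumes "A \<in> carrier_mat m n"
  shows "0 \<le> spec_norm A"
proof -
  have "vnorm (0\<^sub>v n) \<le> 1" unfolding vnorm_def by simp
  then have "vnorm (A *\<^sub>v 0\<^sub>v n) \<le> spec_norm A" by (intro vnorm_mult_le_spec_norm[OF assms]) auto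
  then show ?thesis using vnorm_nonneg[of "A *\<^sub>v 0\<^sub>v n"] by linarith
qed

lemma mult_mat_vec_spec_norm_bound:
  assumes A: "A \<in> carrier_mat m n" and x: "x \<in> carrier_vec n"
  shows "(A *\<^sub>v x) \<bullet> (A *\<^sub>v x) \<le> (spec_norm A)\<^sup>2 * (x \<bullet> x)"
proof (cases "x = 0\<^sub>v n")
  case True
  have "A *\<^sub>v 0\<^sub>v n = 0\<^sub>v m" using A by (intro eq_vecI) auto
  then show ?thesis using True by simp
next
  case False
  then have xx: "0 < x \<bullet> x" using scalar_prod_self_eq_0_iff[OF x] scalar_prod_ge_0_real[of x] by simp
  then have nx: "0 < vnorm x" unfolding vnorm_def by simp
  let ?z = "(1 / vnorm x) \<cdot>\<^sub>v x"
  have z: "?z \<in> carrier_vec n" using x by simp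
  have "?z \<bullet> ?z = (x \<bullet> x) / (vnorm x)\<^sup>2" using x by (simp add: power2_eq_square)
  then have "vnorm ?z \<le> 1" unfolding vnorm_sq vnorm_def using xx by simp
  then have "vnorm (A *\<^sub>v ?z) \<le> spec_norm A" by (rule vnorm_mult_le_spec_norm[OF A z])
  then have "(vnorm (A *\<^sub>v ?z))\<^sup>2 \<le> (spec_norm A)\<^sup>2" by (intro power_mono) auto
  moreover have "(vnorm (A *\<^sub>v ?z))\<^sup>2 = ((A *\<^sub>v x) \<bullet> (A *\<^sub>v x)) / (x \<bullet> x)"
  proof -
    have Ax: "A *\<^sub>v x \<in> carrier_vec m" using A x by simp
    have "A *\<^sub>v ?z = (1 / vnorm x) \<cdot>\<^sub>v (A *\<^sub>v x)" using A x by (simp add: mult_mat_vec)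
    then show ?thesis unfolding vnorm_sq[of "A *\<^sub>v ?z"] vnorm_sq[of x, symmetric]
      using Ax by (simp add: power2_eq_square)
  qed
  ultimately show ?thesis using xx by (simp add: divide_le_eq)
qed

lemma spec_norm_pos:
  assumes A: "A \<in> carrier_mat m n" "A \<noteq> 0\<^sub>m m n"
  shows "0 < spec_norm A"
proof (rule ccontr)
  assume "\<not> 0 < spec_norm A"
  then have "spec_norm A = 0" using spec_norm_nonneg[OF A(1)] by simp
  then have z: "A *\<^sub>v x = 0\<^sub>v m" if "x \<in> carrier_vec n" for x
    using mult_mat_vec_spec_norm_bound[OF A(1) that] scalar_prod_ge_0_real[of "A *\<^sub>v x"]
      scalar_prod_self_eq_0_iff[of "A *\<^sub>v x" m] A(1) that by simp
  have "A = 0\<^sub>m m n"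
  proof (rule eq_matI)
    fix i j assume "i < dim_row (0\<^sub>m m n)" "j < dim_col (0\<^sub>m m n)"
    then have ij: "i < m" "j < n" by auto
    have "A $$ (i,j) = (A *\<^sub>v unit_vec n j) $ i" using A(1) ij by simp
    also have "\<dots> = 0" using z[of "unit_vec n j"] ij by simp
    finally show "A $$ (i,j) = 0\<^sub>m m n $$ (i,j)" using ij by simp
  qed (use A in auto)
  then show False using A(2) by simp
qed

section \<open>The sampling theorem\<close>

text \<open>With \<open>p\<close> a fixed fraction of \<open>L\<close>, the moment bound decays like
  \<open>r exp (- p)\<close>; the logarithm in the hypothesis on \<open>d\<close> makes
  \<open>p\<close> large enough to absorb \<open>r\<close>. The restriction on
  \<open>\<delta>\<close> keeps that logarithm away from 0 even for \<open>r = 1\<close>.\<close>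

lemma tail_estimate:
  fixes r \<epsilon> \<delta> :: real and d :: nat
  assumes r: "1 \<le> r" and \<epsilon>: "0 < \<epsilon>" "\<epsilon> < 1" and \<delta>: "0 < \<delta>" "\<delta> < 1 / 2"
    and d: "960 * (r / (\<epsilon> ^ 4 * \<delta>)) * ln (r / (\<epsilon> ^ 4 * \<delta>)) \<le> real d"
  defines "t \<equiv> \<epsilon>\<^sup>2 * real d / (2 * r)"
  shows "\<exists>p\<ge>1. 2 * real p \<le> real d * (1 / r) \<and> 0 < t \<and>
    2 * real d * (10 * real p * real d * (1 / r)) ^ (p - 1) / t ^ (2 * p) \<le> exp (- (1 / 4) / \<delta>)"
proof -
  define L where "L = real d * \<epsilon> ^ 4 / r"
  have e4: "0 < \<epsilon> ^ 4" "\<epsilon> ^ 4 \<le> 1" using \<epsilon> by (auto intro: power_le_one)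
  have ln2: "1 / 2 \<le> ln (2 :: real)"
    using ln_ge_iff[of 2 "1 / 2"] exp_bound_half[of "1 / 2 :: real"] by simp
  have "\<epsilon> ^ 4 * \<delta> \<le> 1 * (1 / 2)" using e4 \<delta> by (intro mult_mono) auto
  then have "r / (1 / 2) \<le> r / (\<epsilon> ^ 4 * \<delta>)" using r e4 \<delta> by (intro divide_left_mono) auto
  then have "2 * r \<le> r / (\<epsilon> ^ 4 * \<delta>)" by simp
  then have lnr: "ln 2 + ln r \<le> ln (r / (\<epsilon> ^ 4 * \<delta>))"
    using r by (subst ln_mult_pos[symmetric]) auto
  have "960 / \<delta> * ln (r / (\<epsilon> ^ 4 * \<delta>)) = 960 * (r / (\<epsilon> ^ 4 * \<delta>)) * ln (r / (\<epsilon> ^ 4 * \<delta>)) * (\<epsilon> ^ 4 / r)"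
    using r e4 \<delta> by (simp add: field_simps)
  also have "\<dots> \<le> real d * (\<epsilon> ^ 4 / r)" using d e4 r by (intro mult_right_mono) auto
  finally have "960 / \<delta> * ln (r / (\<epsilon> ^ 4 * \<delta>)) \<le> L" unfolding L_def by simp
  moreover have "960 / \<delta> * (ln 2 + ln r) \<le> 960 / \<delta> * ln (r / (\<epsilon> ^ 4 * \<delta>))"
    using lnr \<delta> by (intro mult_left_mono) auto
  ultimately have L: "960 / \<delta> * (ln 2 + ln r) \<le> L" by linarith
  have "ln r \<ge> 0" using r by simp
  have d1: "2 \<le> 1 / \<delta>" using \<delta> by (simp add: field_simps)
  define D where "D = 1 / \<delta>"
  have "2 * ln r \<le> D * ln r" using d1 \<open>ln r \<ge> 0\<close> unfolding D_def by (rule mult_right_mono)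
  moreover have "D * (1 / 2) \<le> D * ln 2" unfolding D_def using ln2 \<delta> by (intro mult_left_mono) auto
  moreover have "960 * (D * ln 2 + D * ln r) \<le> L"
    using L unfolding D_def by (simp add: algebra_simps add_divide_distrib)
  moreover have "480 * D + 1920 * l \<le> L" if "2 * l \<le> Y" "D * (1 / 2) \<le> X" "960 * (X + Y) \<le> L" for l X Y
    using that by (simp add: field_simps)
  \<comment> \<open>After division by 120, \<open>p\<close> is at least
    \<open>4 / \<delta> + 16 ln r - 1\<close>: the first term pays for the exponent and the
    rounding, the second for the factor \<open>r\<close>.\<close>
  ultimately have L': "480 * (1 / \<delta>) + 1920 * ln r \<le> L" unfolding D_def[symmetric] by metis
  \<comment> \<open>\<open>120\<close> makes the ratio \<open>40 * p / L\<close> below at most \<open>1 / 3 \<le> exp (- 1)\<close>\<close>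
  define p where "p = nat \<lfloor>L / 120\<rfloor>"
  have "960 \<le> L" using L' d1 \<open>ln r \<ge> 0\<close> by linarith
  then have p: "real p \<le> L / 120" "L / 120 - 1 \<le> real p" "1 \<le> p"
    unfolding p_def by (auto simp: le_nat_iff le_floor_iff intro: order_less_imp_le) linarith+
  have dpos: "0 < real d" using \<open>960 \<le> L\<close> r unfolding L_def by (auto intro: gr0I)
  have "L \<le> real d / r" unfolding L_def using e4 r by (intro divide_right_mono mult_left_le) auto
  then have 1: "2 * real p \<le> real d * (1 / r)" using p(1) \<open>960 \<le> L\<close> by simp
  have t: "0 < t" unfolding t_def using \<epsilon> dpos r by simp
  have t2: "t\<^sup>2 = \<epsilon> ^ 4 * (real d)\<^sup>2 / (4 * r\<^sup>2)"
    unfolding t_def by (simp add: power_divide power_mult_distrib flip: power_mult)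
  have q: "10 * real p * real d * (1 / r) / t\<^sup>2 = 40 * real p / L"
    unfolding L_def t2 using dpos r \<epsilon> by (simp add: field_simps power2_eq_square)
  also have "\<dots> \<le> 1 / 3" using p(1) \<open>960 \<le> L\<close> by (simp add: field_simps)
  also have "\<dots> \<le> exp (- 1)" using exp_le by (simp add: exp_minus field_simps)
  finally have q1: "10 * real p * real d * (1 / r) / t\<^sup>2 \<le> exp (- 1)" .
  let ?c = "10 * real p * real d * (1 / r)"
  have c: "0 < ?c" using p(3) dpos r by simp
  \<comment> \<open>The exponent \<open>p - 1\<close> against \<open>2 p\<close> leaves one power of
    \<open>t\<^sup>2\<close> unpaired. Completing the ratio costs the prefactor
    \<open>2 d / ?c = r / (5 p)\<close>, from which \<open>d\<close> has cancelled.\<close>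
  have "2 * real d * ?c ^ (p - 1) / t ^ (2 * p) = (2 * real d / ?c) * (?c / t\<^sup>2) ^ p"
  proof -
    have "x ^ (p - 1) = x ^ p / x" if "0 < x" for x :: real
      using p(3) that by (cases p) auto
    from this[OF c] have e: "?c ^ (p - 1) = ?c ^ p / ?c" .
    have "2 * real d * ?c ^ (p - 1) / t ^ (2 * p) = (2 * real d / ?c) * (?c ^ p / (t\<^sup>2) ^ p)"
      unfolding e power_mult[of t 2 p] by (simp only: times_divide_times_eq) (simp only: times_divide_eq_right divide_divide_eq_left)
    then show ?thesis by (simp only: power_divide)
  qed
  also have "\<dots> \<le> r * exp (- 1) ^ p"
  proof (rule mult_mono)
    have "2 * real d / ?c = r / (5 * real p)" using dpos r p(3) by (simp add: field_simps)
    also have "\<dots> \<le> r / 1" using r p(3) by (intro divide_left_mono) auto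
    finally show "2 * real d / ?c \<le> r" by simp
    show "(?c / t\<^sup>2) ^ p \<le> exp (- 1) ^ p" using q1 c t by (intro power_mono divide_nonneg_nonneg) (auto intro: less_imp_le)
    show "0 \<le> (?c / t\<^sup>2) ^ p" using c t by (intro zero_le_power divide_nonneg_nonneg) (auto intro: less_imp_le)
  qed (use r in auto)
  also have "\<dots> = exp (ln r - real p)"
    using r by (simp add: exp_diff exp_minus exp_of_nat_mult[symmetric] inverse_eq_divide power_one_over)
  also have "\<dots> \<le> exp (- (1 / 4) / \<delta>)"
    using p(2) L' d1 \<open>ln r \<ge> 0\<close> by simp
  finally show ?thesis using p(3) 1 t by blast
qed

text \<open>The frame consists of the normalised rows. Its bound \<open>1 / r\<close> is
  \<open>\<parallel>A x\<parallel>\<^sup>2 \<le> S\<^sup>2 \<parallel>x\<parallel>\<^sup>2\<close>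
  divided by \<open>F\<^sup>2\<close>. The event \<open>E\<close> may be any consequence of the
  approximation bound for all \<open>k\<close>.\<close>

lemma sample_prob_ge:
  assumes A: "A \<in> carrier_mat m n" and A0: "A \<noteq> 0\<^sub>m m n" and \<epsilon>: "0 < \<epsilon>"
    and d: "0 < d" and p: "1 \<le> p" "2 * real p \<le> real d * (1 / r)"
    and r: "r = (fro_norm A)\<^sup>2 / (spec_norm A)\<^sup>2" and t: "t = \<epsilon>\<^sup>2 * real d / (2 * r)"
    and E: "\<And>J. (\<And>s. s < d \<Longrightarrow> J s < m) \<Longrightarrow>
      (\<And>k P. is_top_proj (sampled_mat A d J) k P \<Longrightarrow>
        spec_norm (A - A * P) \<le> sing_val A (k + 1) + \<epsilon> * spec_norm A) \<Longrightarrow> E J"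
  shows "1 - 2 * real d * (10 * real p * real d * (1 / r)) ^ (p - 1) / t ^ (2 * p) \<le> sample_prob A d E"
proof -
  define F S where "F = fro_norm A" and "S = spec_norm A"
  have S: "0 < S" unfolding S_def by (rule spec_norm_pos[OF A A0])
  have F: "0 < F" using spec_norm_le_fro_norm[OF A] S unfolding S_def F_def by simp
  have r': "r = F\<^sup>2 / S\<^sup>2" unfolding r F_def S_def ..
  have rpos: "0 < r" unfolding r' using F S by simp
  define w where "w j = (vnorm (row A j))\<^sup>2 / F\<^sup>2" for j
  \<comment> \<open>a zero row gives \<open>y j = 0\<close>, since \<open>1 / 0 = 0\<close>; it has weight \<open>0\<close>\<close>
  define y where "y j = (1 / vnorm (row A j)) \<cdot>\<^sub>v row A j" for j
  have row: "row A j \<in> carrier_vec n" for j using A by auto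
  have wy: "w j * (y j \<bullet> x)\<^sup>2 = (row A j \<bullet> x)\<^sup>2 / F\<^sup>2" if x: "x \<in> carrier_vec n" for j x
  proof (cases "vnorm (row A j) = 0")
    case True
    then have "row A j = 0\<^sub>v n"
      using vnorm_sq[of "row A j"] scalar_prod_self_eq_0_iff[OF row] by simp
    then show ?thesis using x True unfolding w_def by simp
  next
    case False
    then show ?thesis unfolding w_def y_def using x row[of j] by (simp add: power_mult_distrib power_divide)
  qed
  have wyA: "(\<Sum>j<m. w j * (y j \<bullet> x)\<^sup>2) = ((A *\<^sub>v x) \<bullet> (A *\<^sub>v x)) / F\<^sup>2" if "x \<in> carrier_vec n" for x
    unfolding scalar_prod_mult_mat_vec[OF A] using wy[OF that] by (simp add: sum_divide_distrib)
  interpret weighted_frame d m n w y "1 / r"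
  proof
    show "0 \<le> w j" for j unfolding w_def by simp
    show "(\<Sum>j<m. w j) = 1"
      unfolding w_def sum_divide_distrib[symmetric] fro_norm_sq_rows[OF A, symmetric] using F unfolding F_def by simp
    show "y j \<in> carrier_vec n" for j unfolding y_def using row by simp
    show "y j \<bullet> y j \<le> 1" for j
      unfolding y_def using row[of j] vnorm_sq[of "row A j"] by (simp add: divide_simps power2_eq_square)
    show "(\<Sum>j<m. w j * (y j \<bullet> x)\<^sup>2) \<le> 1 / r * (x \<bullet> x)" if x: "x \<in> carrier_vec n" for x
      unfolding wyA[OF x] r'
      using mult_mat_vec_spec_norm_bound[OF A x] F S unfolding S_def[symmetric] by (simp add: divide_simps mult.commute)
  qed
  have tpos: "0 < t" unfolding t using \<epsilon> d rpos by simp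
  have good: "E J" if J: "J \<in> choices"
    and dev: "\<forall>x\<in>carrier_vec n. \<bar>(deviation J *\<^sub>v x) \<bullet> x\<bar> \<le> t * (x \<bullet> x)" for J
  proof (rule E)
    show Jm: "J s < m" if "s < d" for s using choicesD[OF J that] .
    let ?At = "sampled_mat A d J"
    have At: "?At \<in> carrier_mat d n" unfolding sampled_mat_def using A by auto
    have rowAt: "row ?At s = y (J s)" if "s < d" for s
      unfolding y_def sampled_mat_def using A Jm[OF that] that by (intro eq_vecI) auto
    fix k P assume P: "is_top_proj ?At k P"
    \<comment> \<open>The factor \<open>F\<^sup>2 / d\<close> rescales the sampled Gram matrix to
      have mean \<open>A\<^sup>T A\<close>. It turns the deviation level \<open>t\<close> into
      \<open>\<epsilon>\<^sup>2 S\<^sup>2 / 2\<close>, chosen so that the resulting square root is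
      \<open>\<epsilon> S\<close>.\<close>
    have "spec_norm (A - A * P) \<le> sing_val A (k + 1) + sqrt (2 * (\<epsilon>\<^sup>2 * S\<^sup>2 / 2))"
    proof (rule top_proj_spec_norm_bound[OF A At _ _ _ P, where \<kappa> = "F\<^sup>2 / real d"])
      fix x :: "real vec" assume x: "x \<in> carrier_vec n"
      have "(?At *\<^sub>v x) \<bullet> (?At *\<^sub>v x) = (\<Sum>s<d. (y (J s) \<bullet> x)\<^sup>2)"
        unfolding scalar_prod_mult_mat_vec[OF At] by (simp add: rowAt)
      then have dx: "(deviation J *\<^sub>v x) \<bullet> x = (?At *\<^sub>v x) \<bullet> (?At *\<^sub>v x) - real d * (((A *\<^sub>v x) \<bullet> (A *\<^sub>v x)) / F\<^sup>2)"
        unfolding deviation_form[OF J x x] wyA[OF x, symmetric] by (simp add: power2_eq_square)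
      have "(A *\<^sub>v x) \<bullet> (A *\<^sub>v x) - F\<^sup>2 / real d * ((?At *\<^sub>v x) \<bullet> (?At *\<^sub>v x))
          = - (F\<^sup>2 / real d * ((deviation J *\<^sub>v x) \<bullet> x))"
        unfolding dx using d F by (simp add: field_simps)
      then have "\<bar>(A *\<^sub>v x) \<bullet> (A *\<^sub>v x) - F\<^sup>2 / real d * ((?At *\<^sub>v x) \<bullet> (?At *\<^sub>v x))\<bar>
          = F\<^sup>2 / real d * \<bar>(deviation J *\<^sub>v x) \<bullet> x\<bar>"
        by (simp add: abs_mult)
      also have "\<dots> \<le> F\<^sup>2 / real d * (t * (x \<bullet> x))" using dev x by (intro mult_left_mono) auto
      also have "\<dots> = \<epsilon>\<^sup>2 * S\<^sup>2 / 2 * (x \<bullet> x)" unfolding t r' using d F S by (simp add: field_simps)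
      finally show "\<bar>(A *\<^sub>v x) \<bullet> (A *\<^sub>v x) - F\<^sup>2 / real d * ((?At *\<^sub>v x) \<bullet> (?At *\<^sub>v x))\<bar> \<le> \<epsilon>\<^sup>2 * S\<^sup>2 / 2 * (x \<bullet> x)" .
    qed auto
    also have "sqrt (2 * (\<epsilon>\<^sup>2 * S\<^sup>2 / 2)) = \<epsilon> * S" using \<epsilon> S by (simp add: real_sqrt_mult)
    finally show "spec_norm (A - A * P) \<le> sing_val A (k + 1) + \<epsilon> * spec_norm A" unfolding S_def .
  qed
  have "1 - 2 * real d * (10 * real p * real d * (1 / r)) ^ (p - 1) / t ^ (2 * p)
    \<le> expect (\<lambda>J. if \<forall>x\<in>carrier_vec n. \<bar>(deviation J *\<^sub>v x) \<bullet> x\<bar> \<le> t * (x \<bullet> x) then 1 else 0)"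
    using rpos by (intro deviation_tail tpos p) simp
  also have "\<dots> \<le> expect (\<lambda>J. if E J then 1 else 0)" by (rule expect_mono) (use good in auto)
  also have "\<dots> = sample_prob A d E"
    unfolding expect_def sample_prob_def choices_def w_def F_def using A by (intro sum.cong) auto
  finally show ?thesis .
qed

theorem theorem1p1:
  "\<exists>C c :: real. C > 0 \<and> c > 0 \<and>
    (\<forall>(m::nat) (n::nat) (A::real mat) (\<epsilon>::real) (\<delta>::real) (d::nat).
       A \<in> carrier_mat m n \<longrightarrow> A \<noteq> 0\<^sub>m m n \<longrightarrow>
       0 < \<epsilon> \<longrightarrow> \<epsilon> < 1 \<longrightarrow> 0 < \<delta> \<longrightarrow> \<delta> < 1 \<longrightarrow> d \<le> m \<longrightarrow>
       (let r = (fro_norm A)\<^sup>2 / (spec_norm A)\<^sup>2 in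
          real d \<ge> C * (r / (\<epsilon> ^ 4 * \<delta>)) * ln (r / (\<epsilon> ^ 4 * \<delta>))) \<longrightarrow>
       sample_prob A d (\<lambda>J. \<forall>k::nat. k \<ge> 1 \<longrightarrow>
          (\<forall>P. is_top_proj (sampled_mat A d J) k P \<longrightarrow>
             spec_norm (A - A * P) \<le> sing_val A (k + 1) + \<epsilon> * spec_norm A))
         \<ge> 1 - 2 * exp (- c / \<delta>))"
proof (rule exI[of _ "960 :: real"], rule exI[of _ "1 / 4 :: real"], intro conjI allI impI)
  fix m n d :: nat and A :: "real mat" and \<epsilon> \<delta> :: real
  assume A: "A \<in> carrier_mat m n" and A0: "A \<noteq> 0\<^sub>m m n" and \<epsilon>: "0 < \<epsilon>" "\<epsilon> < 1" and \<delta>: "0 < \<delta>" "\<delta> < 1"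
    and "let r = (fro_norm A)\<^sup>2 / (spec_norm A)\<^sup>2 in
          real d \<ge> 960 * (r / (\<epsilon> ^ 4 * \<delta>)) * ln (r / (\<epsilon> ^ 4 * \<delta>))"
  then have d: "960 * (r / (\<epsilon> ^ 4 * \<delta>)) * ln (r / (\<epsilon> ^ 4 * \<delta>)) \<le> real d"
    if "r = (fro_norm A)\<^sup>2 / (spec_norm A)\<^sup>2" for r using that by (simp add: Let_def)
  let ?E = "\<lambda>J. \<forall>k::nat. k \<ge> 1 \<longrightarrow> (\<forall>P. is_top_proj (sampled_mat A d J) k P \<longrightarrow>
             spec_norm (A - A * P) \<le> sing_val A (k + 1) + \<epsilon> * spec_norm A)"
  \<comment> \<open>\<open>tail_estimate\<close> covers \<open>\<delta> < 1 / 2\<close>. The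
    constant \<open>1 / 4\<close> settles the remaining case, where
    \<open>2 exp (- (1 / 4) / \<delta>) \<ge> 2 exp (- (1 / 2)) \<ge> 1\<close>.\<close>
  show "1 - 2 * exp (- (1 / 4) / \<delta>) \<le> sample_prob A d ?E"
  proof (cases "\<delta> < 1 / 2")
    case True
    define r where "r = (fro_norm A)\<^sup>2 / (spec_norm A)\<^sup>2"
    have "0 < spec_norm A" by (rule spec_norm_pos[OF A A0])
    then have r: "1 \<le> r" unfolding r_def using spec_norm_le_fro_norm[OF A] by simp
    obtain p where p: "1 \<le> p" "2 * real p \<le> real d * (1 / r)" "0 < \<epsilon>\<^sup>2 * real d / (2 * r)"
      "2 * real d * (10 * real p * real d * (1 / r)) ^ (p - 1) / (\<epsilon>\<^sup>2 * real d / (2 * r)) ^ (2 * p) \<le> exp (- (1 / 4) / \<delta>)"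
      using tail_estimate[OF r \<epsilon> \<delta>(1) True d[OF r_def]] by blast
    have "0 < d" using p(3) by (cases d) auto
    have "1 - 2 * exp (- (1 / 4) / \<delta>) \<le> 1 - exp (- (1 / 4) / \<delta>)" by simp
    also have "\<dots> \<le> 1 - 2 * real d * (10 * real p * real d * (1 / r)) ^ (p - 1) / (\<epsilon>\<^sup>2 * real d / (2 * r)) ^ (2 * p)"
      using p(4) by simp
    also have "\<dots> \<le> sample_prob A d ?E"
      by (rule sample_prob_ge[OF A A0 \<epsilon>(1) \<open>0 < d\<close> p(1,2) r_def refl]) blast
    finally show ?thesis .
  next
    \<comment> \<open>the claimed lower bound is not positive\<close>
    case False
    then have "- (1 / 2) \<le> - (1 / 4) / \<delta>" using \<delta> by (simp add: field_simps)
    then have "1 / 2 \<le> exp (- (1 / 4) / \<delta>)"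
      using exp_ge_add_one_self[of "- (1 / 4) / \<delta>"] by linarith
    moreover have "0 \<le> sample_prob A d ?E"
      unfolding sample_prob_def by (intro sum_nonneg) (auto intro!: prod_nonneg)
    ultimately show ?thesis by linarith
  qed
qed auto

end
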